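(* For every integer $k\ge 1$ there exists an (explicit) constant $\mu_k>m(\gamma_k^1)$ such that any $(k,\mu_k)$-admissible word $\theta$ has, up to transposition, one of the following forms: (1) $\theta=\dots 1_4\,2^*\,2\,1_2\dots$, or (2) $\theta=\dots 2_{2k}\,1_2\,2_{2k+2}\,1_2\,2_{2k}\,1_2\,2^*\,2_{2k}\,1_2\,2_{2k+2}\,1_2\,2_{2k}\,1\dots$, or (3) $\theta=\dots 1_2\,2_{2m}\,1_2\,2^*\,2_{2m+1}\,1_2\,2_2\dots$ for some integer $m$ with $1\le m<k$, or (4) $\theta=\dots 2_2\,1_2\,2_{2m-1}\,1_2\,2^*\,2_{2m}\,1_2\,2_2\dots$ for some integer $m$ with $1<m<k-1$. Moreover, a $(k,\mu_k)$-admissible word of the form $\theta=\dots 1_4\,2^*\,2\,1_2\dots$ cannot be extended as $\dots 1_{2j}\,2^*\,2\,1_{2m}\dots$ with positive integers $j,m$ satisfying $\lfloor (2k-1)\log 3/\log 2\rfloor+3<j\le m+1$.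
   Context: All words are over the alphabet $\{1,2\}$. Subscripts indicate repetition of a character (e.g. $1_2 2_4$ is $112222$), and an asterisk marks the entry in position $0$; writing $\theta=\dots u\dots$ means that $\theta$ contains the string $u$ with its starred entry at position $0$. For $\theta=(a_n)_{n\in\mathbb{Z}}\in\{1,2\}^{\mathbb{Z}}$ put $\lambda_i(\theta)=[a_i;a_{i+1},a_{i+2},\dots]+[0;a_{i-1},a_{i-2},\dots]$ and $m(\theta)=\sup_{i\in\mathbb{Z}}\lambda_i(\theta)$. For $k\ge1$ let $\underline{\omega}_k=2_{2k}\,1_2\,2_{2k+1}\,1_2\,2_{2k+2}\,1_2$, let $\theta(\underline{\omega}_k)$ be the bi-infinite periodic word obtained by repeating $\underline{\omega}_k$, and let $\gamma_k^1=\overline{\underline{\omega}_k}\,\underline{\omega}_k\,\underline{\omega}_k\,\overline{2}$ be the bi-infinite word consisting of infinitely many copies of $\underline{\omega}_k$ to the left, then two further copies of $\underline{\omega}_k$, then infinitely many $2$'s to the right. A word $\theta\in\{1,2\}^{\mathbb{Z}}$ is $(k,\lambda)$-admissible if $m(\theta(\underline{\omega}_k))<m(\theta)=\lambda_0(\theta)<\lambda$. The transposition of $\theta=(a_n)_{n\in\mathbb{Z}}$ is $(a_{-n})_{n\in\mathbb{Z}}$; "up to transposition" means that $\theta$ or its transposition has the stated form. *)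

theory Defs
  imports "HOL-Analysis.Analysis"
begin

text \<open>A bi-infinite word $\theta = (a_n)_{n \in \mathbb{Z}}$ is a function \<open>int \<Rightarrow> nat\<close>; finite
  strings are lists. Having letters in $\{1,2\}$ is part of \<open>admissible\<close>.\<close>

text \<open>\<open>cf_convergent a n\<close> is $[a_0; a_1, \dots, a_n]$.\<close>

primrec cf_convergent :: "(nat \<Rightarrow> nat) \<Rightarrow> nat \<Rightarrow> real" where
  "cf_convergent a 0 = real (a 0)"
| "cf_convergent a (Suc n) = real (a 0) + 1 / cf_convergent (\<lambda>i. a (Suc i)) n"

definition cf :: "(nat \<Rightarrow> nat) \<Rightarrow> real" where
  "cf a = lim (cf_convergent a)"

definition lambda_at :: "int \<Rightarrow> (int \<Rightarrow> nat) \<Rightarrow> real" where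
  "lambda_at i \<theta> =
     cf (\<lambda>n. \<theta> (i + int n)) + cf (\<lambda>n. if n = 0 then 0 else \<theta> (i - int n))"

text \<open>For words over $\{1,2\}$ the values \<open>lambda_at i \<theta>\<close> are bounded, so the conditionally
  complete supremum on the reals is the intended one.\<close>

definition markov :: "(int \<Rightarrow> nat) \<Rightarrow> real" where
  "markov \<theta> = (SUP i. lambda_at i \<theta>)"

definition omega :: "nat \<Rightarrow> nat list" where
  "omega k = replicate (2 * k) 2 @ replicate 2 1
           @ replicate (2 * k + 1) 2 @ replicate 2 1
           @ replicate (2 * k + 2) 2 @ replicate 2 1"

text \<open>The word obtained by repeating \<open>w\<close>, with a copy of \<open>w\<close> starting at position 0.\<close>

definition periodic :: "nat list \<Rightarrow> int \<Rightarrow> nat" where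
  "periodic w i = w ! nat (i mod int (length w))"

text \<open>The choice of position 0 in \<open>periodic (omega k)\<close> and \<open>gamma1 k\<close> is immaterial, as only
  their \<open>markov\<close> values are used. In \<open>gamma1\<close>, infinitely many copies of \<open>omega k\<close> occupy the
  negative positions and the two further copies start at position 0.\<close>

definition gamma1 :: "nat \<Rightarrow> int \<Rightarrow> nat" where
  "gamma1 k i = (if i < 2 * int (length (omega k)) then periodic (omega k) i else 2)"

definition admissible :: "nat \<Rightarrow> real \<Rightarrow> (int \<Rightarrow> nat) \<Rightarrow> bool" where
  "admissible k l \<theta> \<longleftrightarrow>
     range \<theta> \<subseteq> {1, 2} \<and>
     markov (periodic (omega k)) < markov \<theta> \<and>
     markov \<theta> = lambda_at 0 \<theta> \<and>
     lambda_at 0 \<theta> < l"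

definition transposition :: "(int \<Rightarrow> nat) \<Rightarrow> int \<Rightarrow> nat" where
  "transposition \<theta> n = \<theta> (- n)"

text \<open>\<open>has_form u v \<theta>\<close>: the word $\theta = \dots u\,v \dots$ contains the string \<open>u @ v\<close>
  with the first letter of \<open>v\<close>, the starred one, at position 0.\<close>

definition has_form :: "nat list \<Rightarrow> nat list \<Rightarrow> (int \<Rightarrow> nat) \<Rightarrow> bool" where
  "has_form u v \<theta> \<longleftrightarrow>
     (\<forall>i < length (u @ v). \<theta> (int i - int (length u)) = (u @ v) ! i)"

end

theory Submission
  imports Defs "HOL-Library.Stream"
begin

text \<open>At the star of a word $\beta^{T} 1_2\, 2^* \alpha$ one has
  $\lambda - 3 = [0;\alpha] - [0;2\beta]$. So $\lambda$ slightly above 3 means that $\alpha$ and $2\beta$ have a long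
  common prefix followed by a difference of the right sign. If that prefix is $2_n$, the difference is of
  order $q_n^{-2}$. Prefixes with $n < 2k$ give values above $\mu_k$, which forbids odd
  blocks $2_{2m+1}$ with $m < k$ and bounds the growth of even blocks. Prefixes with $n > 2k$ give values below
  $m(\theta(\underline{\omega}_k))$. Two equal blocks of twos lead to form (3) or to a forbidden odd block, so form (4) does not
  occur at all. There remain words $2_{2k} 1_2 2^* 2_{2k} 1_2$, where all values have the same order of magnitude.
  Each further block $2_{2k}$ acts by one and the same Moebius map, so comparing two continuations reduces to
  comparing rational numbers that do not depend on $k$, and this leaves only form (2). In the last part the common prefix is
  $2\, 1_{2j-2}$, and a crude contraction estimate puts $\lambda$ below $m(\theta(\underline{\omega}_k))$.\<close>

text \<open>The formula for \<lambda> - 3 comes from \<open>[0;1,1,s] = 1 - [0;2,s]\<close>, which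
  turns the string \<open>1_2\<close> before the star into a leading 2 with a minus sign. The
  obstacle is uniformity in k: all differences that matter shrink like \<open>q_n^-2\<close> with n
  = 2k. So \<lambda> - 3 is mostly not estimated but compared with \<open>excess\<close> at a fixed
  reference point. The powers of \<open>q_n\<close> then cancel, and k survives only through
  \<open>r = q_(n-1)/q_n\<close>, which lies in [2/5, 5/12] for n \<ge> 2. The reference points come
  from the string 2 2 1 1 2. It follows the outer blocks \<open>2_n\<close> on both sides of the
  decisive star, in the periodic word as well as in \<open>gamma1\<close>, and every word that
  begins with it has a value between 0.4187 and 0.41903. The lower end serves the periodic word,
  0.4192 serves \<open>gamma1\<close>, and 0.42 leaves room for the strict inequality while staying
  below the configurations that have to be excluded from above.\<close>

declare One_nat_def [simp del]

section \<open>Continued fractions of half-infinite words over {1,2}\<close>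

definition words12 :: "nat stream set" where
  "words12 = streams {1, 2}"

text \<open>This is \<open>[0; s_0, s_1, ...]\<close>, the contribution of one side of the word to
  \<lambda>.\<close>

definition cfrac :: "nat stream \<Rightarrow> real" where
  "cfrac s = 1 / cf (snth s)"

text \<open>The bound 4/3 = 1 + 1/3 needs at least one division, hence n > 0. It supplies the
  contraction factor 3/4 of the Cauchy estimate.\<close>

lemma cf_convergent_bounds:
  assumes "range a \<subseteq> {1, 2}"
  shows "1 \<le> cf_convergent a n \<and> cf_convergent a n \<le> 3 \<and> (n > 0 \<longrightarrow> 4/3 \<le> cf_convergent a n)"
  using assms
proof (induction n arbitrary: a)
  case 0
  then have "a 0 \<in> {1,2}" by blast
  then show ?case by auto
next
  case (Suc n)
  have a0: "a 0 \<in> {1,2}" using Suc.prems by blast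
  have "range (\<lambda>i. a (Suc i)) \<subseteq> {1,2}" using Suc.prems by blast
  from Suc.IH[OF this] have x: "1 \<le> cf_convergent (\<lambda>i. a (Suc i)) n" "cf_convergent (\<lambda>i. a (Suc i)) n \<le> 3" by auto
  define x where "x = cf_convergent (\<lambda>i. a (Suc i)) n"
  have "0 < 1 / x" "1 / x \<le> 1" "1/3 \<le> 1 / x" using x by (auto simp: x_def[symmetric] field_simps)
  moreover have "real (a 0) = 1 \<or> real (a 0) = 2" using a0 by auto
  moreover have "cf_convergent a (Suc n) = real (a 0) + 1 / x" by (simp add: x_def)
  ultimately show ?case by linarith
qed

text \<open>Dropping the first letter leaves
  \<open>\<bar>1/x - 1/y\<bar> = \<bar>x - y\<bar> / (x y)\<close>. Here x y \<ge> 4/3, because x is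
  a convergent of depth n + p > 0 unless both convergents coincide.\<close>

lemma cf_convergent_Cauchy:
  assumes "range a \<subseteq> {1, 2}"
  shows "\<bar>cf_convergent a (n + p) - cf_convergent a n\<bar> \<le> (3/4) ^ n"
  using assms
proof (induction n arbitrary: a)
  case 0
  show ?case
  proof (cases p)
    case (Suc q)
    have "range (\<lambda>i. a (Suc i)) \<subseteq> {1,2}" using 0 by blast
    from cf_convergent_bounds[OF this, of q] show ?thesis using Suc by (auto simp: field_simps)
  qed simp
next
  case (Suc n)
  define b where "b = (\<lambda>i. a (Suc i))"
  have b: "range b \<subseteq> {1,2}" using Suc.prems unfolding b_def by blast
  define x y where "x = cf_convergent b (n + p)" and "y = cf_convergent b n"
  have xy: "1 \<le> x" "1 \<le> y" using cf_convergent_bounds[OF b] unfolding x_def y_def by auto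
  have IH: "\<bar>x - y\<bar> \<le> (3/4) ^ n" using Suc.IH[OF b] by (simp add: x_def y_def)
  have "\<bar>1 / x - 1 / y\<bar> \<le> 3/4 * \<bar>x - y\<bar>"
  proof (cases "p = 0")
    case True then show ?thesis by (simp add: x_def y_def)
  next
    case False
    then have "4/3 \<le> x" using cf_convergent_bounds[OF b, of "n+p"] unfolding x_def by auto
    then have "4/3 * 1 \<le> x * y" using xy by (intro mult_mono) auto
    then have p: "1 / (x * y) \<le> 3/4" by (simp add: field_simps)
    have "\<bar>1 / x - 1 / y\<bar> = \<bar>x - y\<bar> * (1 / (x * y))"
    proof -
      have "1 / x - 1 / y = (y - x) / (x * y)" using xy by (simp add: field_simps)
      then show ?thesis using xy by (simp add: abs_minus_commute)
    qed
    also have "\<dots> \<le> \<bar>x - y\<bar> * (3/4)" using p by (intro mult_left_mono) auto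
    finally show ?thesis by simp
  qed
  then show ?case using IH by (simp add: x_def y_def b_def)
qed

lemma cf_convergent_convergent:
  assumes "range a \<subseteq> {1, 2}"
  shows "convergent (cf_convergent a)"
proof -
  have "Cauchy (cf_convergent a)"
  proof (rule metric_CauchyI)
    fix e :: real assume "e > 0"
    then obtain N where N: "(3/4::real) ^ N < e / 2"
      using real_arch_pow_inv[of "e/2" "3/4"] by auto
    have "dist (cf_convergent a m) (cf_convergent a n) < e" if "N \<le> m" "N \<le> n" for m n
    proof -
      have "\<bar>cf_convergent a m - cf_convergent a N\<bar> \<le> (3/4)^N" "\<bar>cf_convergent a n - cf_convergent a N\<bar> \<le> (3/4)^N"
        using cf_convergent_Cauchy[OF assms, of N "m - N"] cf_convergent_Cauchy[OF assms, of N "n - N"] that by auto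
      then show ?thesis using N by (auto simp: dist_real_def)
    qed
    then show "\<exists>M. \<forall>m\<ge>M. \<forall>n\<ge>M. dist (cf_convergent a m) (cf_convergent a n) < e" by blast
  qed
  then show ?thesis by (simp add: Cauchy_convergent_iff)
qed

lemma cf_limit:
  assumes "range a \<subseteq> {1, 2}"
  shows "cf_convergent a \<longlonglongrightarrow> cf a" "1 \<le> cf a"
proof -
  show l: "cf_convergent a \<longlonglongrightarrow> cf a"
    using cf_convergent_convergent[OF assms] by (simp add: cf_def convergent_LIMSEQ_iff)
  show "1 \<le> cf a"
    by (rule LIMSEQ_le_const[OF l]) (use cf_convergent_bounds[OF assms] in auto)
qed

lemma cf_unfold:
  assumes "range (\<lambda>i. a (Suc i)) \<subseteq> {1, 2}"
  shows "cf a = real (a 0) + 1 / cf (\<lambda>i. a (Suc i))"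
proof -
  note l = cf_limit[OF assms]
  have "(\<lambda>n. cf_convergent a (Suc n)) \<longlonglongrightarrow> real (a 0) + 1 / cf (\<lambda>i. a (Suc i))"
    using l by (auto intro!: tendsto_intros)
  then have "cf_convergent a \<longlonglongrightarrow> real (a 0) + 1 / cf (\<lambda>i. a (Suc i))"
    by (rule LIMSEQ_imp_Suc)
  then show ?thesis by (simp add: cf_def limI)
qed

lemma range_snth: "s \<in> words12 \<Longrightarrow> range (snth s) \<subseteq> {1, 2}"
  by (metis words12_def image_subsetI snth_in streams_iff_sset subset_iff)

lemma words12_Stream [simp]: "a ## s \<in> words12 \<longleftrightarrow> (a = 1 \<or> a = 2) \<and> s \<in> words12"
  by (auto simp: words12_def streams_Stream)

lemma words12_replicate [simp]:
  "replicate n 2 @- s \<in> words12 \<longleftrightarrow> s \<in> words12"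
  "replicate n 1 @- s \<in> words12 \<longleftrightarrow> s \<in> words12"
  by (induction n) auto

lemma cfrac_Stream:
  assumes "s \<in> words12"
  shows "cfrac (a ## s) = 1 / (real a + cfrac s)"
proof -
  have "cf (snth (a ## s)) = real a + 1 / cf (snth s)"
    using cf_unfold[of "snth (a ## s)"] range_snth[OF assms] by simp
  then show ?thesis by (simp add: cfrac_def)
qed

lemma words12_cases:
  assumes "s \<in> words12"
  obtains s' where "s = 1 ## s'" "s' \<in> words12" | s' where "s = 2 ## s'" "s' \<in> words12"
  using assms by (cases s) auto

lemma cfrac_bounds1: "s \<in> words12 \<Longrightarrow> 0 < cfrac s \<and> cfrac s \<le> 1"
  using cf_limit[OF range_snth] by (force simp: cfrac_def)

text \<open>Since \<open>1 / (a + t)\<close> decreases in a and in t, bounds l and u valid for all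
  words produce new ones. Iteration converges to the true extremes \<open>(sqrt 3 - 1)/2\<close> and
  \<open>sqrt 3 - 1\<close>, attained at the two words alternating 1 and 2. Six rounds give the four
  digits of \<open>cfrac_bounds\<close>.\<close>

lemma cfrac_bounds_step:
  assumes "\<And>s. s \<in> words12 \<Longrightarrow> l \<le> cfrac s \<and> cfrac s \<le> u" "0 \<le> l" "s \<in> words12"
  shows "1 / (2 + u) \<le> cfrac s \<and> cfrac s \<le> 1 / (1 + l)"
  using assms(3)
proof (cases rule: words12_cases)
  case (1 s')
  have "l \<le> cfrac s'" "cfrac s' \<le> u" "0 < cfrac s'" using assms(1)[OF 1(2)] cfrac_bounds1[OF 1(2)] by auto
  then show ?thesis using assms(2) by (auto simp: 1 cfrac_Stream[OF 1(2)] intro!: frac_le)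
next
  case (2 s')
  have "l \<le> cfrac s'" "cfrac s' \<le> u" "0 < cfrac s'" using assms(1)[OF 2(2)] cfrac_bounds1[OF 2(2)] by auto
  then show ?thesis using assms(2) by (auto simp: 2 cfrac_Stream[OF 2(2)] intro!: frac_le)
qed

lemma cfrac_bounds:
  assumes "s \<in> words12"
  shows "(3658/10000) \<le> cfrac s" "cfrac s \<le> (7322/10000)"
proof -
  have 0: "0 \<le> cfrac s \<and> cfrac s \<le> 1" if "s \<in> words12" for s
    using cfrac_bounds1[OF that] by auto
  have 1: "1/3 \<le> cfrac s \<and> cfrac s \<le> 1" if "s \<in> words12" for s
    using cfrac_bounds_step[OF 0 _ that] by auto
  have 2: "1/3 \<le> cfrac s \<and> cfrac s \<le> 3/4" if "s \<in> words12" for s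
    using cfrac_bounds_step[OF 1 _ that] by auto
  have 3: "4/11 \<le> cfrac s \<and> cfrac s \<le> 3/4" if "s \<in> words12" for s
    using cfrac_bounds_step[OF 2 _ that] by auto
  have 4: "4/11 \<le> cfrac s \<and> cfrac s \<le> 11/15" if "s \<in> words12" for s
    using cfrac_bounds_step[OF 3 _ that] by auto
  have 5: "15/41 \<le> cfrac s \<and> cfrac s \<le> 11/15" if "s \<in> words12" for s
    using cfrac_bounds_step[OF 4 _ that] by auto
  have 6: "15/41 \<le> cfrac s \<and> cfrac s \<le> 41/56" if "s \<in> words12" for s
    using cfrac_bounds_step[OF 5 _ that] by auto
  from 6[OF assms] show "(3658/10000) \<le> cfrac s" "cfrac s \<le> (7322/10000)" by auto
qed

text \<open>0.5773 and the 0.4227 of the next lemma are 1/1.7322 and 1/2.3658, rounded outwards.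
  Their distance, about 0.155, is the margin available when two words differ in their first
  letter.\<close>

lemma cfrac_1_bounds:
  assumes "s \<in> words12"
  shows "(5773/10000) \<le> cfrac (1 ## s)"
  using cfrac_bounds[OF assms] by (simp add: cfrac_Stream[OF assms] field_simps)

lemma cfrac_2_bounds:
  assumes "s \<in> words12"
  shows "cfrac (2 ## s) \<le> (4227/10000)"
  using cfrac_bounds[OF assms] by (simp add: cfrac_Stream[OF assms] field_simps)

section \<open>Long blocks of twos\<close>

text \<open>The Moebius map \<open>t -> (p_n + p_(n-1) t) / (q_n + q_(n-1) t)\<close> that prefixes
  \<open>2_n\<close> to a word of value t.\<close>

primrec twos :: "nat \<Rightarrow> real \<Rightarrow> real" where
  "twos 0 t = t"
| "twos (Suc n) t = 1 / (2 + twos n t)"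

text \<open>If $p_n/q_n$ are the convergents of $[0;2,2,\dots]$, then these are $q_{n-1}/q_n$ and $q_n$.\<close>

primrec twos_ratio :: "nat \<Rightarrow> real" where
  "twos_ratio 0 = 0"
| "twos_ratio (Suc n) = 1 / (2 + twos_ratio n)"

primrec twos_denom :: "nat \<Rightarrow> real" where
  "twos_denom 0 = 1"
| "twos_denom (Suc n) = twos_denom n * (2 + twos_ratio n)"

lemma cfrac_twos: "s \<in> words12 \<Longrightarrow> cfrac (replicate n 2 @- s) = twos n (cfrac s)"
  by (induction n) (auto simp: cfrac_Stream)

lemma twos_add: "twos (m + n) t = twos m (twos n t)"
  by (induction m) auto

lemma twos_Suc': "twos (Suc n) t = twos n (1 / (2 + t))"
  by (induction n) auto

lemma twos_nonneg: "0 \<le> t \<Longrightarrow> 0 \<le> twos n t"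
  by (induction n) auto

lemma twos_ratio_bounds: "0 \<le> twos_ratio n" "twos_ratio n \<le> 1/2"
proof -
  show *: "0 \<le> twos_ratio n" for n by (induction n) auto
  show "twos_ratio n \<le> 1/2" using *[of "n-1"] by (cases n) (auto simp: field_simps)
qed

text \<open>2/5 and 5/12 are the ratios for n = 2 and n = 3, and \<open>r -> 1/(2 + r)\<close> maps
  the interval between them into itself.\<close>

lemma twos_ratio_bounds2:
  assumes "n \<ge> 2"
  shows "2/5 \<le> twos_ratio n" "twos_ratio n \<le> 5/12"
proof -
  have "2/5 \<le> twos_ratio n \<and> twos_ratio n \<le> 5/12"
    using assms
  proof (induction n rule: dec_induct)
    case base
    then show ?case by (simp add: numeral_2_eq_2)
  next
    case (step n)
    then show ?case by (auto simp: field_simps)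
  qed
  then show "2/5 \<le> twos_ratio n" "twos_ratio n \<le> 5/12" by auto
qed

lemma twos_denom_ge: "n \<ge> 2 \<Longrightarrow> 5 \<le> twos_denom n"
proof (induction n rule: dec_induct)
  case base
  then show ?case by (simp add: numeral_2_eq_2)
next
  case (step n)
  have "5 * 1 \<le> twos_denom n * (2 + twos_ratio n)"
    using step twos_ratio_bounds[of n] by (intro mult_mono) auto
  then show ?case by simp
qed

lemma twos_denom_pos: "0 < twos_denom n"
  using twos_ratio_bounds by (induction n) (auto intro!: mult_pos_pos add_pos_nonneg)

lemma twos_denom_le: "twos_denom n \<le> 3 ^ n"
proof (induction n)
  case (Suc n)
  have "twos_denom n * (2 + twos_ratio n) \<le> 3 ^ n * 3"
    using Suc twos_ratio_bounds[of n] by (intro mult_mono) (auto)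
  then show ?case by simp
qed simp

text \<open>The difference formula of a Moebius map with determinant \<plusminus>1, with
  \<open>q_n\<close> taken out of both denominators. The induction peels off the innermost 2
  (\<open>twos_Suc'\<close>), because that produces the recursions of \<open>twos_ratio\<close> and
  \<open>twos_denom\<close>.\<close>

lemma twos_diff:
  assumes "0 \<le> x" "0 \<le> y"
  shows "twos n x - twos n y = (-1) ^ n * ((x - y) /
    (twos_denom n ^ 2 * ((1 + twos_ratio n * x) * (1 + twos_ratio n * y))))"
  using assms
proof (induction n arbitrary: x y)
  case (Suc n)
  define r q where "r = twos_ratio n" and "q = twos_denom n"
  have r: "0 \<le> r" and q: "0 < q" using twos_ratio_bounds twos_denom_pos by (auto simp: r_def q_def)
  have p: "2 + x > 0" "2 + y > 0" "2 + r > 0" "r + (2 + x) > 0" "r + (2 + y) > 0" using Suc.prems r by auto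
  have "twos (Suc n) x - twos (Suc n) y = (-1) ^ n * ((1 / (2 + x) - 1 / (2 + y)) /
    (q ^ 2 * ((1 + r * (1 / (2 + x))) * (1 + r * (1 / (2 + y))))))"
    using Suc.IH[of "1 / (2 + x)" "1 / (2 + y)"] Suc.prems by (simp add: twos_Suc' r_def q_def del: twos.simps)
  also have "(1 / (2 + x) - 1 / (2 + y)) = - (x - y) / ((2 + x) * (2 + y))"
    using p by (simp add: field_simps)
  also have "(1 + r * (1 / (2 + x))) * (1 + r * (1 / (2 + y))) =
     (r + (2 + x)) * (r + (2 + y)) / ((2 + x) * (2 + y))"
    using p by (simp add: field_simps)
  also have "- (x - y) / ((2 + x) * (2 + y)) / (q\<^sup>2 * ((r + (2 + x)) * (r + (2 + y)) / ((2 + x) * (2 + y))))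
      = - (x - y) / (q\<^sup>2 * ((r + (2 + x)) * (r + (2 + y))))"
    using p q by simp
  also have "(r + (2 + x)) * (r + (2 + y)) = (2 + r)^2 * ((1 + 1 / (2 + r) * x) * (1 + 1 / (2 + r) * y))"
  proof -
    have "r + (2 + x) = (2 + r) * (1 + 1 / (2 + r) * x)" "r + (2 + y) = (2 + r) * (1 + 1 / (2 + r) * y)"
      using p by (simp_all add: field_simps)
    then show ?thesis by (simp only: power2_eq_square mult_ac)
  qed
  also have "q^2 * \<dots> = (q * (2 + r))^2 * ((1 + 1 / (2 + r) * x) * (1 + 1 / (2 + r) * y))"
    by (simp only: power_mult_distrib mult.assoc)
  finally have "twos (Suc n) x - twos (Suc n) y = (-1) ^ n *
    (- (x - y) / ((q * (2 + r))^2 * ((1 + 1 / (2 + r) * x) * (1 + 1 / (2 + r) * y))))" .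
  also have "\<dots> = (-1) ^ Suc n *
    ((x - y) / ((q * (2 + r))^2 * ((1 + 1 / (2 + r) * x) * (1 + 1 / (2 + r) * y))))"
    by (simp only: power_Suc minus_divide_left mult_minus_left mult_minus_right mult_1_left)
  finally show ?case by (simp only: r_def q_def twos_ratio.simps twos_denom.simps)
qed simp

lemma twos_mono:
  assumes "0 \<le> y" "y \<le> x"
  shows "even n \<Longrightarrow> twos n y \<le> twos n x" "odd n \<Longrightarrow> twos n x \<le> twos n y"
proof -
  define d where "d = (x - y) / (twos_denom n ^ 2 * ((1 + twos_ratio n * x) * (1 + twos_ratio n * y)))"
  have e: "twos n x - twos n y = (-1)^n * d" using twos_diff[of x y n] assms by (simp add: d_def)
  have "0 \<le> d" unfolding d_def using assms twos_ratio_bounds by (intro divide_nonneg_nonneg) auto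
  then show "even n \<Longrightarrow> twos n y \<le> twos n x" "odd n \<Longrightarrow> twos n x \<le> twos n y" using e by auto
qed

lemma inverse_diff_contract:
  fixes x y c :: real
  assumes "0 \<le> x" "0 \<le> y" "0 < c"
  shows "\<bar>1 / (c + x) - 1 / (c + y)\<bar> \<le> \<bar>x - y\<bar> / c\<^sup>2"
proof -
  have "1 / (c + x) - 1 / (c + y) = (y - x) / ((c + x) * (c + y))" using assms by (simp add: field_simps)
  then have "\<bar>1 / (c + x) - 1 / (c + y)\<bar> = \<bar>x - y\<bar> / ((c + x) * (c + y))"
    using assms by (simp add: abs_mult abs_minus_commute)
  also have "\<dots> \<le> \<bar>x - y\<bar> / c\<^sup>2"
    using assms unfolding power2_eq_square by (intro divide_left_mono mult_mono mult_pos_pos) auto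
  finally show ?thesis .
qed

lemma twos_contract:
  assumes "0 \<le> x" "0 \<le> y" "0 < n"
  shows "\<bar>twos n x - twos n y\<bar> \<le> \<bar>x - y\<bar> / 4"
  using assms(3)
proof (induction n rule: nat_induct_non_zero)
  case 1
  show ?case using inverse_diff_contract[of x y 2] assms by (simp add: One_nat_def)
next
  case (Suc n)
  have "\<bar>1 / (2 + twos n x) - 1 / (2 + twos n y)\<bar> \<le> \<bar>twos n x - twos n y\<bar> / 4"
    using inverse_diff_contract[of "twos n x" "twos n y" 2] twos_nonneg assms by simp
  also have "\<dots> \<le> \<bar>twos n x - twos n y\<bar>" by simp
  also note Suc.IH
  finally show ?case by simp
qed

lemma divide_le_divide_iff_pos: "0 < (b::real) \<Longrightarrow> 0 < d \<Longrightarrow> a / b \<le> c / d \<longleftrightarrow> a * d \<le> c * b"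
  by (simp add: divide_simps)

text \<open>The prefix scales both differences by the same \<open>q_n^-2\<close>; only the factors
  (1 + r x)(1 + r y) differ. They are at least 1, and at most (11/8)^2 < 2 when x, y \<le> 3/4 and r
  \<le> 1/2. So a factor 2 between the differences of the tails settles the comparison for every
  n.\<close>

lemma twos_compare:
  assumes "0 \<le> x'" "0 \<le> y'" "0 \<le> y" "y \<le> x" "x \<le> 3/4" "2 * \<bar>x' - y'\<bar> \<le> x - y"
  shows "\<bar>twos n x' - twos n y'\<bar> \<le> \<bar>twos n x - twos n y\<bar>"
proof -
  define r q where "r = twos_ratio n" and "q = twos_denom n"
  have r: "0 \<le> r" "r \<le> 1/2" and q: "0 < q" using twos_ratio_bounds twos_denom_pos by (auto simp: r_def q_def)
  have d: "1 \<le> (1 + r * x') * (1 + r * y')"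
    using mult_mono[of 1 "1 + r * x'" 1 "1 + r * y'"] r assms by auto
  have "r * x \<le> 1/2 * (3/4)" "r * y \<le> 1/2 * (3/4)" using r assms by (intro mult_mono; simp)+
  then have "(1 + r * x) * (1 + r * y) \<le> (1 + 3/8) * (1 + 3/8)" using r assms by (intro mult_mono) auto
  then have c: "(1 + r * x) * (1 + r * y) \<le> 2" by simp
  have e: "0 < (1 + r * x) * (1 + r * y)" using r assms by (intro mult_pos_pos add_pos_nonneg) auto
  have "\<bar>x' - y'\<bar> * ((1 + r * x) * (1 + r * y)) \<le> \<bar>x' - y'\<bar> * 2" using c by (intro mult_left_mono) auto
  also have "\<dots> \<le> (x - y) * 1" using assms by simp
  also have "\<dots> \<le> (x - y) * ((1 + r * x') * (1 + r * y'))" using d assms by (intro mult_left_mono) auto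
  finally have "\<bar>x' - y'\<bar> / ((1 + r * x') * (1 + r * y')) \<le> (x - y) / ((1 + r * x) * (1 + r * y))"
    using d e by (subst divide_le_divide_iff_pos) linarith+
  then have "\<bar>x' - y'\<bar> / (q^2 * ((1 + r * x') * (1 + r * y'))) \<le> (x - y) / (q^2 * ((1 + r * x) * (1 + r * y)))"
    using q divide_right_mono[of _ _ "q^2"] by (fastforce simp: mult.commute)
  moreover have "0 \<le> r * x'" "0 \<le> r * y'" "0 \<le> r * x" "0 \<le> r * y" using r assms by auto
  moreover have "\<bar>twos n x' - twos n y'\<bar> = \<bar>x' - y'\<bar> / (q^2 * ((1 + r * x') * (1 + r * y')))"
    using twos_diff[of x' y' n] assms \<open>0 \<le> r * x'\<close> \<open>0 \<le> r * y'\<close> by (simp add: r_def q_def abs_mult power_abs)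
  moreover have "\<bar>twos n x - twos n y\<bar> = (x - y) / (q^2 * ((1 + r * x) * (1 + r * y)))"
    using twos_diff[of x y n] assms \<open>0 \<le> r * x\<close> \<open>0 \<le> r * y\<close> by (simp add: r_def q_def abs_mult power_abs)
  ultimately show ?thesis by simp
qed

lemma twos_diff_even:
  assumes "even n" "0 \<le> x" "0 \<le> y"
  shows "twos n x - twos n y = (x - y) / ((1 + twos_ratio n * x) * (1 + twos_ratio n * y)) / twos_denom n ^ 2"
  using twos_diff[OF assms(2,3), of n] assms(1) by (simp add: mult.commute)

lemma twos_le_1: "0 \<le> t \<Longrightarrow> t \<le> 1 \<Longrightarrow> twos n t \<le> 1"
proof (induction n)
  case (Suc n)
  then show ?case using twos_nonneg[of t n] by simp
qed simp

lemma twos_range: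
  assumes "2 \<le> n" "0 \<le> t" "t \<le> 1"
  shows "2/5 \<le> twos n t" "twos n t \<le> 3/7"
proof -
  obtain m where m: "n = Suc (Suc m)" using le_Suc_ex[OF assms(1)] by auto
  define z where "z = twos m t"
  have z: "0 \<le> z" "z \<le> 1" using twos_nonneg twos_le_1 assms by (auto simp: z_def)
  have e: "twos n t = (2 + z) / (5 + 2 * z)" using z by (simp add: m z_def[symmetric] field_simps)
  show "2/5 \<le> twos n t" "twos n t \<le> 3/7" unfolding e using z by (auto simp: divide_simps)
qed

section \<open>Comparison of the critical values\<close>

text \<open>The value of 1 1 w for a word w of value X; \<open>ext_211\<close> prefixes 2 1 1 in the
  same way.\<close>

definition ext_11 :: "real \<Rightarrow> real" where "ext_11 X = 1 / (1 + 1 / (1 + X))"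

definition ext_211 :: "real \<Rightarrow> real" where "ext_211 Y = 1 / (2 + ext_11 Y)"

lemma ext_11_eq: "0 \<le> X \<Longrightarrow> ext_11 X = (1 + X) / (2 + X)"
  by (simp add: ext_11_def field_simps)

lemma ext_211_eq: "0 \<le> Y \<Longrightarrow> ext_211 Y = (2 + Y) / (5 + 3 * Y)"
  by (simp add: ext_211_def ext_11_eq field_simps)

lemma ext_11_mono: "0 \<le> x \<Longrightarrow> x \<le> y \<Longrightarrow> ext_11 x \<le> ext_11 y"
  by (simp add: ext_11_eq divide_simps) (simp add: algebra_simps)

lemma ext_211_antimono: "0 \<le> x \<Longrightarrow> x \<le> y \<Longrightarrow> ext_211 y \<le> ext_211 x"
  by (simp add: ext_211_eq divide_simps) (simp add: algebra_simps)

lemma ext_11_nonneg: "0 \<le> x \<Longrightarrow> 0 \<le> ext_11 x" by (simp add: ext_11_def)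
lemma ext_211_nonneg: "0 \<le> x \<Longrightarrow> 0 \<le> ext_211 x" by (simp add: ext_211_def ext_11_nonneg)

text \<open>With $n = 2k$ this is $\lambda - 3$ at a starred letter in
  $\dots\,2_n 1_2 2_n 1_2 2^* 2_n 1_2 2_n\dots$, where $x$ and $y$ are the values of what follows the outer blocks
  $2_n$ on the right and on the left. The three reference values used below are
  $x = y = 0.42$ (the choice of $\mu_k - 3$), $x = y = 0.4192$ (above $m(\gamma_k^1) - 3$) and
  $x = y = 0.4187$ (below $m(\theta(\underline{\omega}_k)) - 3$).\<close>

definition excess :: "nat \<Rightarrow> real \<Rightarrow> real \<Rightarrow> real" where
  "excess n x y = twos n (ext_11 (twos n x)) - twos n (ext_211 (twos n y))"

text \<open>For even n the map \<open>twos n\<close> increases, \<open>ext_11\<close> increases too,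
  and the decreasing \<open>ext_211\<close> enters with a minus sign.\<close>

lemma excess_mono:
  assumes "even n" "0 \<le> x" "x \<le> x'" "0 \<le> y" "y \<le> y'"
  shows "excess n x y \<le> excess n x' y'"
proof -
  have "twos n (ext_11 (twos n x)) \<le> twos n (ext_11 (twos n x'))"
    using assms by (intro twos_mono ext_11_mono ext_11_nonneg twos_nonneg) auto
  moreover have "twos n (ext_211 (twos n y')) \<le> twos n (ext_211 (twos n y))"
    using assms by (intro twos_mono ext_211_antimono ext_211_nonneg twos_nonneg) auto
  ultimately show ?thesis by (simp add: excess_def)
qed

text \<open>The composite of the two Moebius maps again has determinant 1, and
  \<open>2 + r + (1 + r) * X\<close> is its denominator divided by \<open>q_n\<close>.\<close>

lemma ext_11_twos_diff:
  assumes "even n" "0 \<le> X" "0 \<le> X'"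
  defines "r \<equiv> twos_ratio n"
  shows "twos n (ext_11 X) - twos n (ext_11 X') =
     (X - X') / ((2 + r + (1 + r) * X) * (2 + r + (1 + r) * X')) / twos_denom n ^ 2"
proof -
  have r: "0 \<le> r" unfolding r_def by (rule twos_ratio_bounds)
  have p: "2 + X > 0" "2 + X' > 0" using assms by auto
  have nz: "2 + r + (1 + r) * X > 0" "2 + r + (1 + r) * X' > 0" using assms r by (auto intro!: add_pos_nonneg)
  have 1: "ext_11 X - ext_11 X' = (X - X') / ((2 + X) * (2 + X'))"
    using assms by (simp add: ext_11_eq divide_simps) (simp add: algebra_simps)
  have 2: "1 + r * ext_11 X = (2 + r + (1 + r) * X) / (2 + X)" "1 + r * ext_11 X' = (2 + r + (1 + r) * X') / (2 + X')"
    using assms(2,3) by (simp_all add: ext_11_eq divide_simps) (simp_all add: algebra_simps)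
  have "twos n (ext_11 X) - twos n (ext_11 X') = (ext_11 X - ext_11 X') / ((1 + r * ext_11 X) * (1 + r * ext_11 X')) / twos_denom n ^ 2"
    unfolding r_def using assms by (intro twos_diff_even ext_11_nonneg) auto
  also have "(ext_11 X - ext_11 X') / ((1 + r * ext_11 X) * (1 + r * ext_11 X')) =
     (X - X') / ((2 + r + (1 + r) * X) * (2 + r + (1 + r) * X'))"
    unfolding 1 2 using p nz by simp
  finally show ?thesis .
qed

lemma ext_211_twos_diff:
  assumes "even n" "0 \<le> Y" "0 \<le> Y'"
  defines "r \<equiv> twos_ratio n"
  shows "twos n (ext_211 Y) - twos n (ext_211 Y') =
     - ((Y - Y') / ((5 + 2 * r + (3 + r) * Y) * (5 + 2 * r + (3 + r) * Y'))) / twos_denom n ^ 2"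
proof -
  have r: "0 \<le> r" unfolding r_def by (rule twos_ratio_bounds)
  have p: "5 + 3 * Y > 0" "5 + 3 * Y' > 0" using assms by auto
  have nz: "5 + 2 * r + (3 + r) * Y > 0" "5 + 2 * r + (3 + r) * Y' > 0" using assms r by (auto intro!: add_pos_nonneg)
  have 1: "ext_211 Y - ext_211 Y' = - (Y - Y') / ((5 + 3 * Y) * (5 + 3 * Y'))"
    using assms by (simp add: ext_211_eq divide_simps) (simp add: algebra_simps)
  have 2: "1 + r * ext_211 Y = (5 + 2 * r + (3 + r) * Y) / (5 + 3 * Y)" "1 + r * ext_211 Y' = (5 + 2 * r + (3 + r) * Y') / (5 + 3 * Y')"
    using assms(2,3) by (simp_all add: ext_211_eq divide_simps) (simp_all add: algebra_simps)
  have "twos n (ext_211 Y) - twos n (ext_211 Y') = (ext_211 Y - ext_211 Y') / ((1 + r * ext_211 Y) * (1 + r * ext_211 Y')) / twos_denom n ^ 2"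
    unfolding r_def using assms by (intro twos_diff_even ext_211_nonneg) auto
  also have "(ext_211 Y - ext_211 Y') / ((1 + r * ext_211 Y) * (1 + r * ext_211 Y')) =
     - ((Y - Y') / ((5 + 2 * r + (3 + r) * Y) * (5 + 2 * r + (3 + r) * Y')))"
    unfolding 1 2 using p nz by (simp add: minus_divide_left)
  finally show ?thesis .
qed

text \<open>Moving $x$ changes the excess about $5.8$ times as much as moving $y$: the string
  $1_2$ on the right corresponds to $2\,1_2$ on the left.\<close>

lemma excess_compare:
  fixes n x y x' y'
  defines "r \<equiv> twos_ratio n"
  defines "a \<equiv> (x' - x) / ((1 + r * x') * (1 + r * x))" and "b \<equiv> (y - y') / ((1 + r * y) * (1 + r * y'))"
  assumes n: "even n" "2 \<le> n" and x: "0 \<le> x" "x \<le> x'" "x' \<le> 1" and y: "0 \<le> y'" "y' \<le> y" "y \<le> 1"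
  shows "b < (56/10) * a \<Longrightarrow> excess n x y < excess n x' y'"
    and "(61/10) * a < b \<Longrightarrow> excess n x' y' < excess n x y"
proof -
  define q where "q = twos_denom n ^ 2"
  have q: "0 < q" using twos_denom_pos[of n] by (simp add: q_def)
  have r: "2/5 \<le> r" "r \<le> 5/12" using twos_ratio_bounds2[OF n(2)] by (auto simp: r_def)
  define A where "A = (\<lambda>x. 2 + r + (1 + r) * twos n x)"
  define B where "B = (\<lambda>y. 5 + 2 * r + (3 + r) * twos n y)"
  have A: "(296/100) \<le> A t \<and> A t \<le> (30239/10000)" if "0 \<le> t" "t \<le> 1" for t
  proof -
    have "(1 + 2/5) * (2/5) \<le> (1 + r) * twos n t" "(1 + r) * twos n t \<le> (1 + 5/12) * (3/7)"
      using r twos_range[OF n(2) that] by (intro mult_mono; linarith)+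
    then show ?thesis using r by (simp add: A_def)
  qed
  have B: "(716/100) \<le> B t \<and> B t \<le> (72977/10000)" if "0 \<le> t" "t \<le> 1" for t
  proof -
    have "(3 + 2/5) * (2/5) \<le> (3 + r) * twos n t" "(3 + r) * twos n t \<le> (3 + 5/12) * (3/7)"
      using r twos_range[OF n(2) that] by (intro mult_mono; linarith)+
    then show ?thesis using r by (simp add: B_def)
  qed
  have Ax: "(296/100) \<le> A x" "A x \<le> (30239/10000)" "(296/100) \<le> A x'" "A x' \<le> (30239/10000)" using A[of x] A[of x'] x by auto
  have By: "(716/100) \<le> B y" "B y \<le> (72977/10000)" "(716/100) \<le> B y'" "B y' \<le> (72977/10000)" using B[of y] B[of y'] y by auto
  have AA: "(296/100) * (296/100) \<le> A x' * A x" "A x' * A x \<le> (30239/10000) * (30239/10000)"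
    using Ax by (intro mult_mono; linarith)+
  have BB: "(716/100) * (716/100) \<le> B y * B y'" "B y * B y' \<le> (72977/10000) * (72977/10000)"
    using By by (intro mult_mono; linarith)+
  have tx: "twos n x' - twos n x = a / q" 
    using twos_diff_even[OF n(1), of x' x] x by (simp add: a_def q_def r_def)
  have ty: "twos n y - twos n y' = b / q" 
    using twos_diff_even[OF n(1), of y y'] y by (simp add: b_def q_def r_def)
  have a: "0 \<le> a" unfolding a_def using x r by (intro divide_nonneg_nonneg mult_nonneg_nonneg) auto
  have b: "0 \<le> b" unfolding b_def using y r by (intro divide_nonneg_nonneg mult_nonneg_nonneg) auto
  have "excess n x' y' - excess n x y = (twos n (ext_11 (twos n x')) - twos n (ext_11 (twos n x)))
      + (twos n (ext_211 (twos n y)) - twos n (ext_211 (twos n y')))"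
    by (simp add: excess_def)
  also have "\<dots> = (a / q) / (A x' * A x) / q + (- ((b / q) / (B y * B y')) / q)"
    using ext_11_twos_diff[OF n(1) twos_nonneg twos_nonneg, of x' x n n] ext_211_twos_diff[OF n(1) twos_nonneg twos_nonneg, of y y' n n] x y
    by (simp add: tx ty A_def B_def q_def[symmetric] r_def)
  also have "\<dots> = (a / (A x' * A x) - b / (B y * B y')) / q\<^sup>2"
    using q by (simp add: field_simps power2_eq_square)
  finally have *: "excess n x' y' - excess n x y = (a / (A x' * A x) - b / (B y * B y')) / q\<^sup>2" .
  have pos: "0 < A x' * A x" "0 < B y * B y'" using AA BB by linarith+
  \<comment> \<open>The sign in \<open>*\<close> is decided by comparing b with a times
    \<open>B y * B y' / (A x' * A x)\<close>. That quotient lies between (7.16/3.0239)^2 > 5.6 and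
    (7.2977/2.96)^2 < 6.1, which is where the two thresholds come from.\<close>
  show "excess n x y < excess n x' y'" if "b < (56/10) * a"
  proof -
    have "b * (A x' * A x) \<le> b * ((30239/10000) * (30239/10000))" using AA b by (intro mult_left_mono) auto
    also have "\<dots> < (56/10) * a * ((30239/10000) * (30239/10000))" using that by simp
    also have "\<dots> \<le> a * ((716/100) * (716/100))" using a by simp
    also have "\<dots> \<le> a * (B y * B y')" using BB a by (intro mult_left_mono) auto
    finally have "b / (B y * B y') < a / (A x' * A x)" using pos by (simp add: divide_simps mult.commute)
    then have "0 < excess n x' y' - excess n x y" unfolding * using q by simp
    then show ?thesis by simp
  qed
  show "excess n x' y' < excess n x y" if "(61/10) * a < b"
  proof -
    have "a * (B y * B y') \<le> a * ((72977/10000) * (72977/10000))" using BB a by (intro mult_left_mono) auto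
    also have "\<dots> \<le> (61/10) * a * ((296/100) * (296/100))" using a by simp
    also have "\<dots> < b * ((296/100) * (296/100))" using that by simp
    also have "\<dots> \<le> b * (A x' * A x)" using AA b by (intro mult_left_mono) auto
    finally have "a / (A x' * A x) < b / (B y * B y')" using pos by (simp add: divide_simps mult.commute)
    then have "excess n x' y' - excess n x y < 0" unfolding * using q by (simp add: divide_less_0_iff)
    then show ?thesis by simp
  qed
qed

lemma divide_product_mono:
  fixes a b a' b' d :: real
  assumes "0 \<le> d" "0 < a" "a \<le> a'" "0 < b" "b \<le> b'"
  shows "d / (a' * b') \<le> d / (a * b)"
proof (rule divide_left_mono)
  show "a * b \<le> a' * b'" using assms by (intro mult_mono) linarith+
  show "0 < a' * b' * (a * b)" using assms by (intro mult_pos_pos) linarith+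
qed (fact assms(1))

lemma ratio_quotient_bounds:
  fixes r :: real
  assumes "2/5 \<le> r" "r \<le> 5/12" "0 \<le> x" "0 \<le> y" "0 \<le> d"
  shows "d / ((1 + 5/12 * x) * (1 + 5/12 * y)) \<le> d / ((1 + r * x) * (1 + r * y))"
    and "d / ((1 + r * x) * (1 + r * y)) \<le> d / ((1 + 2/5 * x) * (1 + 2/5 * y))"
proof -
  note b = mult_right_mono[OF assms(1,3)] mult_right_mono[OF assms(1,4)]
    mult_right_mono[OF assms(2,3)] mult_right_mono[OF assms(2,4)]
  have p: "0 \<le> r * x" "0 \<le> r * y" using assms by auto
  show "d / ((1 + 5/12 * x) * (1 + 5/12 * y)) \<le> d / ((1 + r * x) * (1 + r * y))"
    by (rule divide_product_mono[OF assms(5)]) (use b p in linarith)+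
  show "d / ((1 + r * x) * (1 + r * y)) \<le> d / ((1 + 2/5 * x) * (1 + 2/5 * y))"
    by (rule divide_product_mono[OF assms(5)]) (use b p assms in linarith)+
qed

text \<open>Replacing \<open>twos_ratio n\<close> by the less favourable endpoint of [2/5, 5/12] on
  each side removes n from the hypothesis, so that concrete instances are pure arithmetic.\<close>

lemma excess_less:
  assumes n: "even n" "2 \<le> n" and x: "0 \<le> x" "x \<le> x'" "x' \<le> 1" and y: "0 \<le> y'" "y' \<le> y" "y \<le> 1"
    and h: "(y - y') / ((1 + 2/5 * y) * (1 + 2/5 * y')) < (56/10) * ((x' - x) / ((1 + 5/12 * x') * (1 + 5/12 * x)))"
  shows "excess n x y < excess n x' y'"
proof (intro excess_compare(1) n x y)
  have "(y - y') / ((1 + twos_ratio n * y) * (1 + twos_ratio n * y')) \<le> (y - y') / ((1 + 2/5 * y) * (1 + 2/5 * y'))"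
    using x y by (intro ratio_quotient_bounds(2)[OF twos_ratio_bounds2[OF n(2)]]) auto
  also note h
  also have "(56/10) * ((x' - x) / ((1 + 5/12 * x') * (1 + 5/12 * x))) \<le>
      (56/10) * ((x' - x) / ((1 + twos_ratio n * x') * (1 + twos_ratio n * x)))"
    using x y by (intro mult_left_mono ratio_quotient_bounds(1)[OF twos_ratio_bounds2[OF n(2)]]) auto
  finally show "(y - y') / ((1 + twos_ratio n * y) * (1 + twos_ratio n * y')) <
      (56/10) * ((x' - x) / ((1 + twos_ratio n * x') * (1 + twos_ratio n * x)))" .
qed

lemma excess_less':
  assumes n: "even n" "2 \<le> n" and x: "0 \<le> x" "x \<le> x'" "x' \<le> 1" and y: "0 \<le> y'" "y' \<le> y" "y \<le> 1"
    and h: "(61/10) * ((x' - x) / ((1 + 2/5 * x') * (1 + 2/5 * x))) < (y - y') / ((1 + 5/12 * y) * (1 + 5/12 * y'))"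
  shows "excess n x' y' < excess n x y"
proof (intro excess_compare(2) n x y)
  have "(61/10) * ((x' - x) / ((1 + twos_ratio n * x') * (1 + twos_ratio n * x)))
      \<le> (61/10) * ((x' - x) / ((1 + 2/5 * x') * (1 + 2/5 * x)))"
    using x y by (intro mult_left_mono ratio_quotient_bounds(2)[OF twos_ratio_bounds2[OF n(2)]]) auto
  also note h
  also have "(y - y') / ((1 + 5/12 * y) * (1 + 5/12 * y')) \<le> (y - y') / ((1 + twos_ratio n * y) * (1 + twos_ratio n * y'))"
    using x y by (intro ratio_quotient_bounds(1)[OF twos_ratio_bounds2[OF n(2)]]) auto
  finally show "(61/10) * ((x' - x) / ((1 + twos_ratio n * x') * (1 + twos_ratio n * x))) <
      (y - y') / ((1 + twos_ratio n * y) * (1 + twos_ratio n * y'))" .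
qed

text \<open>The first three inequalities exclude configurations above the upper reference, the next
  three configurations below the lower one, and the last separates \<open>gamma1\<close> from
  \<mu>_k. The decimals are bounds, some of them relaxed, for \<open>cfrac\<close> after short
  strings: 0.5773 after 1, 0.4127 after 2 2, 0.38801 after 2 1, 0.5873 after 1 1 2, 0.4146 after 2 2
  2, 0.41903 after 2 2 1 1 2.\<close>

lemma excess_numeric:
  assumes n: "even n" "2 \<le> n"
  shows "excess n (42/100) (42/100) < excess n (5773/10000) (36/100)"
    and "excess n (42/100) (42/100) < excess n (4127/10000) (577/1000)"
    and "excess n (42/100) (42/100) < excess n (38/100) 1"
    and "excess n (38801/100000) (5873/10000) < excess n (4187/10000) (4187/10000)"
    and "excess n (41903/100000) (4146/10000) < excess n (4187/10000) (4187/10000)"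
    and "excess n (4146/10000) (41903/100000) < excess n (4187/10000) (4187/10000)"
    and "excess n (4192/10000) (4192/10000) < excess n (42/100) (42/100)"
proof -
  show "excess n (42/100) (42/100) < excess n (5773/10000) (36/100)"
    by (rule excess_less[OF n]) auto
  show "excess n (42/100) (42/100) < excess n (4127/10000) (577/1000)"
    by (rule excess_less'[OF n]) auto
  show "excess n (42/100) (42/100) < excess n (38/100) 1"
    by (rule excess_less'[OF n]) auto
  show "excess n (38801/100000) (5873/10000) < excess n (4187/10000) (4187/10000)"
    by (rule excess_less[OF n]) auto
  show "excess n (41903/100000) (4146/10000) < excess n (4187/10000) (4187/10000)"
    by (rule excess_less'[OF n]) auto
  show "excess n (4146/10000) (41903/100000) < excess n (4187/10000) (4187/10000)"
    by (rule excess_less[OF n]) auto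
  have "excess n (4192/10000) (42/100) < excess n (42/100) (42/100)" by (rule excess_less[OF n]) auto
  then show "excess n (4192/10000) (4192/10000) < excess n (42/100) (42/100)"
    by (rule le_less_trans[rotated], intro excess_mono[OF n(1)]) auto
qed

text \<open>The uniform criterion \<open>excess_less\<close> just fails for these numbers, so both
  sides are evaluated as explicit rationals.\<close>

lemma excess_numeric_2: "excess 2 (38677/100000) (62036/100000) < excess 2 (4187/10000) (4187/10000)"
  by (simp add: excess_def ext_11_def ext_211_def numeral_2_eq_2)

section \<open>Common prefixes shorter than, longer than or equal to \<open>2_n\<close>\<close>

lemma ext_range:
  assumes "2/5 \<le> X" "X \<le> 3/7"
  shows "(5833/10000) \<le> ext_11 X" "ext_11 X \<le> (5883/10000)" "(386/1000) \<le> ext_211 X" "ext_211 X \<le> (3872/10000)"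
proof -
  show "(5833/10000) \<le> ext_11 X" "ext_11 X \<le> (5883/10000)" using assms by (auto simp: ext_11_eq divide_simps)
  show "(386/1000) \<le> ext_211 X" "ext_211 X \<le> (3872/10000)" using assms by (auto simp: ext_211_eq divide_simps)
qed

text \<open>After the common prefix \<open>2_j\<close> the two terms of \<open>excess\<close> still
  share a 2, which shrinks their difference from at most 0.2023 to about 0.051. Twice this stays
  below 0.5773 - 0.4227, so \<open>twos_compare\<close> applies.\<close>

lemma excess_le_twos_gap:
  assumes "even n" "2 \<le> n" "j < n" "(5773/10000) \<le> x" "x \<le> (7322/10000)" "0 \<le> y" "y \<le> (4227/10000)"
  shows "excess n (42/100) (42/100) \<le> \<bar>twos j x - twos j y\<bar>"
proof -
  define u v where "u = ext_11 (twos n (42/100))" and "v = ext_211 (twos n (42/100))"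
  have uv: "(5833/10000) \<le> u" "u \<le> (5883/10000)" "(386/1000) \<le> v" "v \<le> (3872/10000)"
    using ext_range[OF twos_range[OF assms(2)]] by (auto simp: u_def v_def)
  obtain i where i: "n = j + i" "0 < i" using assms(3) by (metis less_imp_add_positive)
  have c: "\<bar>twos i u - twos i v\<bar> \<le> \<bar>u - v\<bar> / 4" using uv i by (intro twos_contract) auto
  have "excess n (42/100) (42/100) = twos j (twos i u) - twos j (twos i v)"
    by (simp add: excess_def u_def v_def i twos_add[symmetric])
  also have "\<dots> \<le> \<bar>twos j (twos i u) - twos j (twos i v)\<bar>" by simp
  also have "\<dots> \<le> \<bar>twos j x - twos j y\<bar>"
  proof (intro twos_compare twos_nonneg)
    have "\<bar>u - v\<bar> = u - v" using uv by simp
    then show "2 * \<bar>twos i u - twos i v\<bar> \<le> x - y" using c uv assms by simp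
  qed (use uv assms in auto)
  finally show ?thesis .
qed

text \<open>Now the longer prefix has an extra 2: any difference of values, at most 0.3722, is
  divided by 4, and twice the result is below 0.5833 - 0.3872.\<close>

lemma twos_gap_le_excess:
  assumes "even n" "2 \<le> n" "n < m" "(36/100) \<le> x" "x \<le> (7322/10000)" "(36/100) \<le> y" "y \<le> (7322/10000)"
  shows "\<bar>twos m x - twos m y\<bar> \<le> excess n (4187/10000) (4187/10000)"
proof -
  define u v where "u = ext_11 (twos n (4187/10000))" and "v = ext_211 (twos n (4187/10000))"
  have uv: "(5833/10000) \<le> u" "u \<le> (5883/10000)" "(386/1000) \<le> v" "v \<le> (3872/10000)"
    using ext_range[OF twos_range[OF assms(2)]] by (auto simp: u_def v_def)
  obtain i where i: "m = n + i" "0 < i" using assms(3) by (metis less_imp_add_positive)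
  have c: "\<bar>twos i x - twos i y\<bar> \<le> \<bar>x - y\<bar> / 4" using assms i by (intro twos_contract) auto
  have "\<bar>twos m x - twos m y\<bar> = \<bar>twos n (twos i x) - twos n (twos i y)\<bar>" by (simp add: i twos_add)
  also have "\<dots> \<le> \<bar>twos n u - twos n v\<bar>"
  proof (intro twos_compare twos_nonneg)
    have "\<bar>x - y\<bar> \<le> (3722/10000)" using assms by (intro abs_leI) linarith+
    then show "2 * \<bar>twos i x - twos i y\<bar> \<le> u - v" using c uv by simp
  qed (use uv assms in auto)
  also have "\<dots> = excess n (4187/10000) (4187/10000)"
    using twos_mono(1)[of v u n] assms uv by (simp add: excess_def u_def v_def)
  finally show ?thesis .
qed

text \<open>With equal prefixes nothing is gained by contraction, and 0.5873 - 0.4127 = 0.1746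
  against 0.1961 is too close for the factor 2 of \<open>twos_compare\<close>. Hence the
  denominators are compared explicitly. The case covered is 1 1 2 on the right against 2 2 on the
  left.\<close>

lemma twos_long_gap:
  assumes n: "even n" "2 \<le> n" and u: "0 \<le> u" "u \<le> (5873/10000)" and v: "(4127/10000) \<le> v" 
  shows "twos n u - twos n v \<le> excess n (4187/10000) (4187/10000)"
proof -
  define u' v' where "u' = ext_11 (twos n (4187/10000))" and "v' = ext_211 (twos n (4187/10000))"
  have uv: "(5833/10000) \<le> u'" "u' \<le> (5883/10000)" "(386/1000) \<le> v'" "v' \<le> (3872/10000)"
    using ext_range[OF twos_range[OF n(2)]] by (auto simp: u'_def v'_def)
  have "twos n u - twos n v \<le> twos n (5873/10000) - twos n (4127/10000)"
    using n u v by (intro diff_mono twos_mono) auto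
  also have "\<dots> \<le> twos n (5833/10000) - twos n (3872/10000)"
  proof -
    note r = twos_ratio_bounds2[OF n(2)]
    have "twos n (5873/10000) - twos n (4127/10000) = ((5873/10000) - (4127/10000)) / ((1 + twos_ratio n * (5873/10000)) * (1 + twos_ratio n * (4127/10000))) / twos_denom n ^ 2"
      using n by (intro twos_diff_even) auto
    also have "\<dots> \<le> ((5873/10000) - (4127/10000)) / ((1 + 2/5 * (5873/10000)) * (1 + 2/5 * (4127/10000))) / twos_denom n ^ 2"
      using ratio_quotient_bounds(2)[OF r, of "5873/10000" "4127/10000" "(5873/10000) - (4127/10000)"] by (intro divide_right_mono) auto
    also have "\<dots> \<le> ((5833/10000) - (3872/10000)) / ((1 + 5/12 * (5833/10000)) * (1 + 5/12 * (3872/10000))) / twos_denom n ^ 2"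
      by (intro divide_right_mono) auto
    also have "\<dots> \<le> ((5833/10000) - (3872/10000)) / ((1 + twos_ratio n * (5833/10000)) * (1 + twos_ratio n * (3872/10000))) / twos_denom n ^ 2"
      using ratio_quotient_bounds(1)[OF r, of "5833/10000" "3872/10000" "(5833/10000) - (3872/10000)"] by (intro divide_right_mono) auto
    also have "\<dots> = twos n (5833/10000) - twos n (3872/10000)"
      using n by (intro twos_diff_even[symmetric]) auto
    finally show ?thesis .
  qed
  also have "\<dots> \<le> twos n u' - twos n v'"
    using n uv by (intro diff_mono twos_mono) auto
  finally show ?thesis by (simp add: excess_def u'_def v'_def)
qed

text \<open>Only \<open>q_n\<close> \<ge> 5 is used: 0.2023/25. This is small enough to rule out
  strings for which crude bounds already push \<lambda> further above 3.\<close>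

lemma excess_upper:
  assumes n: "even n" "2 \<le> n"
  shows "excess n (42/100) (42/100) \<le> (82/10000)"
proof -
  define u v where "u = ext_11 (twos n (42/100))" and "v = ext_211 (twos n (42/100))"
  have uv: "(5833/10000) \<le> u" "u \<le> (5883/10000)" "(386/1000) \<le> v" "v \<le> (3872/10000)"
    using ext_range[OF twos_range[OF n(2)]] by (auto simp: u_def v_def)
  have "1 * 1 \<le> (1 + twos_ratio n * u) * (1 + twos_ratio n * v)"
    using uv twos_ratio_bounds[of n] by (intro mult_mono) auto
  moreover have "5^2 \<le> twos_denom n ^ 2" using twos_denom_ge[OF n(2)] by (intro power_mono) auto
  ultimately have "(u - v) / ((1 + twos_ratio n * u) * (1 + twos_ratio n * v)) / twos_denom n ^ 2 \<le> (u - v) / 1 / 25"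
    using uv by (intro frac_le) auto
  also have "\<dots> \<le> 82/10000" using uv by simp
  finally have "(u - v) / ((1 + twos_ratio n * u) * (1 + twos_ratio n * v)) / twos_denom n ^ 2 \<le> 82/10000" by simp
  moreover have "excess n (42/100) (42/100) = (u - v) / ((1 + twos_ratio n * u) * (1 + twos_ratio n * v)) / twos_denom n ^ 2"
    unfolding excess_def u_def[symmetric] v_def[symmetric] using n uv by (intro twos_diff_even) auto
  ultimately show ?thesis by (simp only:)
qed

text \<open>The estimate \<open>q_n \<le> 3^n\<close> is crude, the growth rate being
  \<open>1 + sqrt 2\<close>, but it is the one that matches the quotient log 3 / log 2 in the claim
  on long strings of ones.\<close>

lemma excess_lower:
  assumes n: "even n" "2 \<le> n"
  shows "(13/100) / 9 ^ n \<le> excess n (4187/10000) (4187/10000)"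
proof -
  define u v where "u = ext_11 (twos n (4187/10000))" and "v = ext_211 (twos n (4187/10000))"
  have uv: "(5833/10000) \<le> u" "u \<le> (5883/10000)" "(386/1000) \<le> v" "v \<le> (3872/10000)"
    using ext_range[OF twos_range[OF n(2)]] by (auto simp: u_def v_def)
  have q: "0 < twos_denom n" "twos_denom n ^ 2 \<le> 9 ^ n"
  proof -
    show "0 < twos_denom n" by (rule twos_denom_pos)
    then have "twos_denom n ^ 2 \<le> (3 ^ n) ^ 2" by (intro power_mono twos_denom_le) simp
    also have "\<dots> = 9 ^ n" by (simp add: power_mult[symmetric] mult.commute[of n]) (simp add: power_mult)
    finally show "twos_denom n ^ 2 \<le> 9 ^ n" .
  qed
  have "(13/100) \<le> (u - v) / ((1 + 5/12 * (5883/10000)) * (1 + 5/12 * (3872/10000)))" using uv by simp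
  also have "\<dots> \<le> (u - v) / ((1 + 5/12 * u) * (1 + 5/12 * v))" using uv by (intro divide_left_mono mult_mono) auto
  also have "\<dots> \<le> (u - v) / ((1 + twos_ratio n * u) * (1 + twos_ratio n * v))"
    using uv by (intro ratio_quotient_bounds twos_ratio_bounds2 n) auto
  finally have g: "13/100 \<le> (u - v) / ((1 + twos_ratio n * u) * (1 + twos_ratio n * v))" .
  have "(13/100) / 9 ^ n \<le> (u - v) / ((1 + twos_ratio n * u) * (1 + twos_ratio n * v)) / twos_denom n ^ 2"
  proof (rule frac_le)
    show "0 \<le> (u - v) / ((1 + twos_ratio n * u) * (1 + twos_ratio n * v))"
      using uv twos_ratio_bounds[of n] by (intro divide_nonneg_nonneg mult_nonneg_nonneg) auto
  qed (use g q in auto)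
  moreover have "excess n (4187/10000) (4187/10000) = (u - v) / ((1 + twos_ratio n * u) * (1 + twos_ratio n * v)) / twos_denom n ^ 2"
    unfolding excess_def u_def[symmetric] v_def[symmetric] using n uv by (intro twos_diff_even) auto
  ultimately show ?thesis by simp
qed

lemma excess_pos: "even n \<Longrightarrow> 2 \<le> n \<Longrightarrow> 0 < excess n (4187/10000) (4187/10000)"
  by (rule less_le_trans[OF _ excess_lower]) simp_all

section \<open>Words continuing with 2 2 1 1 after the outer blocks\<close>

definition ext_2211 :: "real \<Rightarrow> real" where "ext_2211 t = twos 2 (ext_11 t)"

lemma ext_2211_eq: "0 \<le> t \<Longrightarrow> ext_2211 t = (5 + 3 * t) / (12 + 7 * t)"
  by (simp add: ext_2211_def ext_11_eq numeral_2_eq_2 field_simps)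

lemma ext_2211_mono: "0 \<le> s \<Longrightarrow> s \<le> t \<Longrightarrow> ext_2211 s \<le> ext_2211 t"
  by (simp add: ext_2211_eq divide_simps) (simp add: algebra_simps)

lemma ext_2211_range:
  assumes "(3658/10000) \<le> t" "t \<le> (4227/10000)"
  shows "(4187/10000) \<le> ext_2211 t" "ext_2211 t \<le> (41903/100000)"
  using assms by (auto simp: ext_2211_eq divide_simps)

lemma ext_2211_diff: "0 \<le> s \<Longrightarrow> 0 \<le> t \<Longrightarrow> ext_2211 s - ext_2211 t = (s - t) / ((12 + 7 * s) * (12 + 7 * t))"
  by (simp add: ext_2211_eq divide_simps) (simp add: algebra_simps)

lemma excess_tail_ge:
  assumes n: "even n" "2 \<le> n" and "0 \<le> x" "x \<le> 1" "0 \<le> y" "y \<le> 1"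
  shows "excess n (4187/10000) (4187/10000) \<le> excess n (ext_2211 (twos n x)) (ext_2211 (twos n y))"
proof -
  have "4187/10000 \<le> ext_2211 (twos n t)" if "0 \<le> t" "t \<le> 1" for t
    using twos_range[OF n(2) that] by (simp add: ext_2211_eq divide_simps)
  then show ?thesis using assms by (intro excess_mono n) auto
qed

text \<open>Both tails sit behind one more block \<open>2_n\<close>, so their effects carry the same
  additional \<open>q_n^-2\<close>, and n drops out again. Passing from 2 to 1 on the right
  contributes at least 0.1 with a weight above 5.6, while the left tail varies by at most 0.3722.
  Thus the next letter on the right decides, whatever stands on the left.\<close>

lemma excess_tail_less:
  assumes n: "even n" "2 \<le> n" and x: "0 \<le> x" "x \<le> (4227/10000)" "(5773/10000) \<le> x'" "x' \<le> (7322/10000)"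
    and y: "(36/100) \<le> y'" "y' \<le> (7322/10000)" "0 \<le> y" "y \<le> (7322/10000)"
  shows "excess n (ext_2211 (twos n x)) (ext_2211 (twos n y)) < excess n (ext_2211 (twos n x')) (ext_2211 (twos n y'))"
proof -
  define r q where "r = twos_ratio n" and "q = twos_denom n ^ 2"
  have r: "2/5 \<le> r" "r \<le> 5/12" and q: "0 < q" using twos_ratio_bounds2[OF n(2)] twos_denom_pos[of n] by (auto simp: r_def q_def)
  \<comment> \<open>The worst case for y: by monotonicity it may be raised to the largest value
    allowed.\<close>
  define z where "z = max y (7322/10000)"
  have z: "z = (7322/10000)" using y by (simp add: z_def)
  define X X' Y' Z where "X = twos n x" and "X' = twos n x'" and "Y' = twos n y'" and "Z = twos n z"
  have XX: "2/5 \<le> X" "X \<le> 3/7" "2/5 \<le> X'" "X' \<le> 3/7" "2/5 \<le> Y'" "Y' \<le> 3/7" "2/5 \<le> Z" "Z \<le> 3/7"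
    using twos_range[OF n(2)] x y z by (auto simp: X_def X'_def Y'_def Z_def)
  have TT: "(4188/10000) \<le> ext_2211 t \<and> ext_2211 t \<le> (4191/10000)" if "2/5 \<le> t" "t \<le> 3/7" for t
    using that by (simp add: ext_2211_eq divide_simps)
  have mono: "excess n (ext_2211 (twos n x)) (ext_2211 (twos n y)) \<le> excess n (ext_2211 X) (ext_2211 Z)"
    unfolding X_def Z_def using x y z n TT[of Y'] XX
    by (intro excess_mono ext_2211_mono twos_mono twos_nonneg order.refl) (auto simp: ext_2211_def intro!: twos_nonneg ext_11_nonneg)
  have "Z - Y' = (z - y') / ((1 + r * z) * (1 + r * y')) / q"
    unfolding Z_def Y'_def r_def q_def using y z n by (intro twos_diff_even) auto
  also have "\<dots> \<le> (z - y') / (1 * 1) / q"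
    using y z r q by (intro divide_right_mono divide_product_mono) auto
  also have "\<dots> \<le> (3722/10000) / q" using y z q by (intro divide_right_mono) auto
  finally have ZY: "Z - Y' \<le> (3722/10000) / q" .
  have "(1/10) \<le> ((5773/10000) - (4227/10000)) / ((1 + 5/12 * (7322/10000)) * (1 + 5/12 * ((4227/10000)::real)))" by simp
  also have "\<dots> \<le> (x' - x) / ((1 + 5/12 * x') * (1 + 5/12 * x))"
    using x by (intro frac_le mult_mono) auto
  also have "\<dots> \<le> (x' - x) / ((1 + r * x') * (1 + r * x))"
    using x r by (intro ratio_quotient_bounds) auto
  finally have "(1/10) / q \<le> (x' - x) / ((1 + r * x') * (1 + r * x)) / q" using q by (intro divide_right_mono) auto
  also have "\<dots> = X' - X"
    unfolding X'_def X_def r_def q_def using x n by (intro twos_diff_even[symmetric]) auto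
  finally have XX': "(1/10) / q \<le> X' - X" .
  have 1: "ext_2211 Z - ext_2211 Y' \<le> ((3722/10000) / q) / 219"
  proof -
    have "(148/10) * (148/10) \<le> (12 + 7 * Z) * (12 + 7 * Y')" using XX by (intro mult_mono) auto
    moreover have "(Z - Y') / ((12 + 7 * Z) * (12 + 7 * Y')) \<le> ((3722/10000) / q) / ((12 + 7 * Z) * (12 + 7 * Y'))"
      using ZY XX by (intro divide_right_mono) auto
    moreover have "((3722/10000) / q) / ((12 + 7 * Z) * (12 + 7 * Y')) \<le> ((3722/10000) / q) / 219"
      using q calculation(1) by (intro divide_left_mono) auto
    ultimately show ?thesis using XX by (simp add: ext_2211_diff)
  qed
  have 2: "((1/10) / q) / 225 \<le> ext_2211 X' - ext_2211 X"
  proof -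
    have "(12 + 7 * X') * (12 + 7 * X) \<le> 15 * 15" "0 < (12 + 7 * X') * (12 + 7 * X)"
      using XX by (intro mult_mono mult_pos_pos; linarith)+
    moreover have "0 \<le> (1/10) / q" using q by simp
    moreover have "0 \<le> X' - X" using XX' calculation(3) by linarith
    ultimately have "((1/10) / q) / 225 \<le> (X' - X) / ((12 + 7 * X') * (12 + 7 * X))"
      using XX' by (intro frac_le) auto
    then show ?thesis using XX by (simp add: ext_2211_diff)
  qed
  have x2: "ext_2211 X \<le> ext_2211 X'" using 2 q by (smt (verit) divide_nonneg_pos)
  have ZY0: "Y' \<le> Z \<or> Z \<le> Y'" by linarith
  have "Y' \<le> Z" unfolding Y'_def Z_def using y z n by (intro twos_mono) auto
  then have y2: "ext_2211 Y' \<le> ext_2211 Z" using XX by (intro ext_2211_mono) auto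
  have "(ext_2211 Z - ext_2211 Y') / ((1 + 2/5 * ext_2211 Z) * (1 + 2/5 * ext_2211 Y')) \<le> (ext_2211 Z - ext_2211 Y') / (1363/1000)"
  proof -
    have "(1 + 2/5 * (4188/10000)) * (1 + 2/5 * (4188/10000)) \<le> (1 + 2/5 * ext_2211 Z) * (1 + 2/5 * ext_2211 Y')"
      using TT[of Z] TT[of Y'] XX by (intro mult_mono) auto
    then show ?thesis using y2 by (intro divide_left_mono) auto
  qed
  also have "\<dots> < (56/10) * ((ext_2211 X' - ext_2211 X) / (138/100))"
  proof -
    \<comment> \<open>About 0.00125/q against 0.00180/q. The numbers 219 and 225 bound products of
      denominators of \<open>ext_2211\<close>; 1.363 and 1.38 bound the factors (1 + r s)(1 + r t)
      for s, t in [0.4188, 0.4191].\<close>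
    have "((3722/10000) / q) / 219 / (1363/1000) < (56/10) * (((1/10) / q) / 225 / (138/100))"
      using q by (simp add: divide_simps)
    then show ?thesis using 1 2 by simp
  qed
  also have "\<dots> \<le> (56/10) * ((ext_2211 X' - ext_2211 X) / ((1 + 5/12 * ext_2211 X') * (1 + 5/12 * ext_2211 X)))"
  proof -
    have "(1 + 5/12 * ext_2211 X') * (1 + 5/12 * ext_2211 X) \<le> (1 + 5/12 * (4191/10000)) * (1 + 5/12 * (4191/10000))"
      "1 * 1 \<le> (1 + 5/12 * ext_2211 X') * (1 + 5/12 * ext_2211 X)"
      using TT[of X] TT[of X'] XX by (intro mult_mono; linarith)+
    then show ?thesis using x2 by (intro mult_left_mono divide_left_mono) auto
  qed
  finally have "excess n (ext_2211 X) (ext_2211 Z) < excess n (ext_2211 X') (ext_2211 Y')"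
    using TT[of X] TT[of X'] TT[of Z] TT[of Y'] XX x2 y2 by (intro excess_less n) auto
  then show ?thesis using mono by (simp add: X'_def Y'_def)
qed

section \<open>Forbidden strings\<close>

lemma Stream_replicate: "a ## (replicate n a @- s) = replicate n a @- (a ## s)"
  by (induction n) auto

lemma replicate_shift_add: "replicate (m + n) a @- s = replicate m a @- (replicate n a @- s)"
  by (simp add: replicate_add)

text \<open>Looking for the end of the initial run only up to length n avoids a separate treatment
  of infinite runs.\<close>

lemma words12_twos_cases:
  assumes "s \<in> words12"
  obtains d s' where "d < n" "s = replicate d 2 @- (1 ## s')" "s' \<in> words12"
    | s' where "s = replicate n 2 @- s'" "s' \<in> words12"
proof -
  have "(\<exists>d s'. d < n \<and> s = replicate d 2 @- (1 ## s') \<and> s' \<in> words12) \<or> (\<exists>s'. s = replicate n 2 @- s' \<and> s' \<in> words12)"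
  proof (induction n)
    case 0
    then show ?case using assms by auto
  next
    case (Suc n)
    then show ?case
    proof (elim disjE exE conjE)
      fix d s' assume "d < n" "s = replicate d 2 @- (1 ## s')" "s' \<in> words12"
      then show ?thesis by (intro disjI1 exI[of _ d] exI[of _ s']) simp
    next
      fix s' assume s': "s = replicate n 2 @- s'" "s' \<in> words12"
      from s'(2) show ?thesis
      proof (cases rule: words12_cases)
        case (1 t)
        then show ?thesis using s' by (intro disjI1 exI[of _ n] exI[of _ t]) simp
      next
        case (2 t)
        then show ?thesis using s' by (intro disjI2 exI[of _ t]) (simp add: Stream_replicate)
      qed
    qed
  qed
  then show ?thesis using that by blast
qed

lemma cfrac_11:
  assumes "s \<in> words12"
  shows "cfrac (1 ## 1 ## s) = ext_11 (cfrac s)" "cfrac (1 ## 1 ## s) = 1 - cfrac (2 ## s)"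
  using cfrac_bounds1[OF assms] assms by (simp_all add: cfrac_Stream ext_11_eq field_simps)

lemma cfrac_211: "s \<in> words12 \<Longrightarrow> cfrac (2 ## 1 ## 1 ## s) = ext_211 (cfrac s)"
  using cfrac_11(1)[of s] by (simp add: cfrac_Stream[of "1 ## 1 ## s"] ext_211_def)

lemma cfrac_2211: "s \<in> words12 \<Longrightarrow> cfrac (2 ## 2 ## 1 ## 1 ## s) = ext_2211 (cfrac s)"
  using cfrac_twos[of "1 ## 1 ## s" 2] cfrac_11(1)[of s] by (simp add: ext_2211_def numeral_2_eq_2)

lemma cfrac_112_le: "s \<in> words12 \<Longrightarrow> cfrac (1 ## 1 ## 2 ## s) \<le> 5873/10000"
  using cfrac_2_bounds[of s] cfrac_bounds1[of "2 ## s"] by (simp add: cfrac_11 ext_11_eq divide_simps)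

lemma cfrac_22_ge: "s \<in> words12 \<Longrightarrow> 4127/10000 \<le> cfrac (2 ## 2 ## s)"
  using cfrac_2_bounds[of s] cfrac_bounds1[of "2 ## s"] by (simp add: cfrac_Stream[of "2 ## s"] divide_simps)

lemma cfrac_222_le: "s \<in> words12 \<Longrightarrow> cfrac (2 ## 2 ## 2 ## s) \<le> 4146/10000"
  using cfrac_2_bounds[of s] cfrac_bounds1[of "2 ## s"]
  by (simp add: cfrac_Stream[of "2 ## s"] cfrac_Stream[of "2 ## 2 ## s"] divide_simps)

lemma cfrac_21_le: "s \<in> words12 \<Longrightarrow> cfrac (2 ## 1 ## s) \<le> 38801/100000"
  using cfrac_1_bounds[of s] cfrac_bounds1[of "1 ## s"] by (simp add: cfrac_Stream[of "1 ## s"] divide_simps)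

lemma cfrac_12_ge: "s \<in> words12 \<Longrightarrow> 7028/10000 \<le> cfrac (1 ## 2 ## s)"
  using cfrac_2_bounds[of s] cfrac_bounds1[of "2 ## s"] by (simp add: cfrac_Stream[of "2 ## s"] divide_simps)

lemma cfrac_22_11_range:
  assumes "s \<in> words12"
  shows "4187/10000 \<le> cfrac (2 ## 2 ## 1 ## 1 ## 2 ## s)" "cfrac (2 ## 2 ## 1 ## 1 ## 2 ## s) \<le> 41903/100000"
  using ext_2211_range[of "cfrac (2 ## s)"] cfrac_2_bounds[OF assms] cfrac_bounds[of "2 ## s"] assms by (auto simp: cfrac_2211)

text \<open>$\lambda - 3$ at the star of $\dots 1_2 2^* r$, where $l$ is read leftwards from the string $1_2$.\<close>

definition gap :: "nat stream \<Rightarrow> nat stream \<Rightarrow> real" where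
  "gap l r = cfrac r - cfrac (2 ## l)"

lemma gap_common_prefix:
  assumes "\<alpha> = replicate n 2 @- x" "2 ## \<beta> = replicate n 2 @- y" "x \<in> words12" "y \<in> words12"
  shows "gap \<beta> \<alpha> = twos n (cfrac x) - twos n (cfrac y)"
  using assms by (simp add: gap_def cfrac_twos)

text \<open>The forms (1), (2), (3) of a word $\dots 1\,2^*\alpha$, where $L$ is read leftwards from
  the letter 1.\<close>

definition form1 :: "nat stream \<Rightarrow> nat stream \<Rightarrow> bool" where
  "form1 L \<alpha> \<longleftrightarrow> (\<exists>l r. L = 1 ## 1 ## 1 ## l \<and> \<alpha> = 2 ## 1 ## 1 ## r)"

definition form2 :: "nat \<Rightarrow> nat stream \<Rightarrow> nat stream \<Rightarrow> bool" where
  "form2 k L \<alpha> \<longleftrightarrow> (\<exists>l r.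
     L = 1 ## (replicate (2 * k) 2 @- (1 ## 1 ## (replicate (2 * k + 2) 2 @- (1 ## 1 ## (replicate (2 * k) 2 @- l))))) \<and>
     \<alpha> = replicate (2 * k) 2 @- (1 ## 1 ## (replicate (2 * k + 2) 2 @- (1 ## 1 ## (replicate (2 * k) 2 @- (1 ## r))))))"

definition form3 :: "nat \<Rightarrow> nat stream \<Rightarrow> nat stream \<Rightarrow> bool" where
  "form3 k L \<alpha> \<longleftrightarrow> (\<exists>m l r. 1 \<le> m \<and> m < k \<and>
     L = 1 ## (replicate (2 * m) 2 @- (1 ## 1 ## l)) \<and>
     \<alpha> = replicate (2 * m + 1) 2 @- (1 ## 1 ## 2 ## 2 ## r))"

text \<open>\<open>C l r\<close> stands for a cut of a fixed bi-infinite word, or of its transposition, into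
  \<open>l\<close>, read leftwards, and \<open>r\<close>.\<close>

locale near_three =
  fixes k :: nat and C :: "nat stream \<Rightarrow> nat stream \<Rightarrow> bool"
  assumes k: "1 \<le> k"
    and sym: "C l r \<Longrightarrow> C r l"
    and move: "C l (a ## r) \<Longrightarrow> C (a ## l) r"
    and words: "C l r \<Longrightarrow> r \<in> words12"
    and bound: "C l (a ## r) \<Longrightarrow> real a + cfrac l + cfrac r < 3 + excess (2 * k) (42/100) (42/100)"
begin

abbreviation "N \<equiv> 2 * k"

lemma N: "even N" "2 \<le> N"
  using k by auto

lemma words': "C l r \<Longrightarrow> l \<in> words12"
  using words sym by blast

lemma move': "C (a ## l) r \<Longrightarrow> C l (a ## r)"
  using move sym by blast

lemma move_twos: "C (replicate n 2 @- l) r \<longleftrightarrow> C l (replicate n 2 @- r)"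
proof (induction n arbitrary: l r)
  case (Suc n)
  show ?case using Suc[of "2 ## l" r] move[of l 2] move'[of 2 l]
    by (auto simp: Stream_replicate[symmetric])
qed simp

lemma gap_bound:
  assumes "C (1 ## 1 ## l) (2 ## r)"
  shows "cfrac r - cfrac (2 ## l) < excess N (42/100) (42/100)"
  using bound[OF assms] words'[OF assms] by (simp add: cfrac_11(2))

text \<open>Here \<lambda> \<ge> 2 + 0.7028 + 0.3658, far above 3.0082.\<close>

lemma no_212: "C (1 ## 2 ## l) (2 ## r) \<Longrightarrow> False"
  using bound[of "1 ## 2 ## l" 2 r] words'[of "1 ## 2 ## l" "2 ## r"] words[of "1 ## 2 ## l" "2 ## r"]
    cfrac_12_ge[of l] cfrac_bounds[of r] excess_upper[OF N] by simp

text \<open>The words to compare are \<open>2_n 1 r\<close> on the right and \<open>2_n 2 l\<close>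
  on the left. An even prefix preserves the order of the tails, so the gap is positive, and as n <
  2k it is too large.\<close>

lemma no_even_gap:
  assumes C: "C (1 ## 1 ## (replicate n 2 @- l)) (2 ## (replicate n 2 @- (1 ## r)))" and n: "even n" "n < N"
  shows False
proof -
  have w: "l \<in> words12" "r \<in> words12" using words[OF C] words'[OF C] by auto
  have x: "5773/10000 \<le> cfrac (1 ## r)" "cfrac (1 ## r) \<le> 7322/10000" using cfrac_1_bounds[OF w(2)] cfrac_bounds[of "1 ## r"] w by auto
  have y: "0 \<le> cfrac (2 ## l)" "cfrac (2 ## l) \<le> 4227/10000" using cfrac_2_bounds[OF w(1)] cfrac_bounds[of "2 ## l"] w by auto
  have "twos n (cfrac (1 ## r)) - twos n (cfrac (2 ## l)) < excess N (42/100) (42/100)"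
    using gap_bound[OF C] w by (simp add: Stream_replicate cfrac_twos)
  moreover have "excess N (42/100) (42/100) \<le> \<bar>twos n (cfrac (1 ## r)) - twos n (cfrac (2 ## l))\<bar>"
    by (rule excess_le_twos_gap[OF N n(2) x y])
  moreover have "twos n (cfrac (2 ## l)) \<le> twos n (cfrac (1 ## r))"
    using x y n by (intro twos_mono) auto
  ultimately show False by simp
qed

text \<open>The common prefix \<open>2_(m+1)\<close> is odd and reverses the order, so here 1 on the
  left against 2 on the right gives a positive gap. The bound m + 3 counts the star, the prefix and
  the deviating 2.\<close>

lemma no_odd_gap:
  assumes C: "C (1 ## 1 ## (replicate m 2 @- (1 ## l))) (replicate b 2 @- r)"
    and m: "even m" "Suc m < N" "m + 3 \<le> b"
  shows False
proof -
  obtain c where "b = m + 3 + c" using le_Suc_ex[OF m(3)] by blast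
  then have "b = Suc (Suc m + Suc c)" by simp
  then have b: "replicate b 2 @- r = 2 ## (replicate (Suc m) 2 @- (2 ## (replicate c 2 @- r)))" (is "_ = 2 ## (_ @- (2 ## ?r))")
    by (simp only: replicate_Suc shift.simps replicate_shift_add)
  have C': "C (1 ## 1 ## (replicate m 2 @- (1 ## l))) (2 ## (replicate (Suc m) 2 @- (2 ## ?r)))"
    using C unfolding b .
  have w: "l \<in> words12" "?r \<in> words12" using words[OF C'] words'[OF C'] by auto
  have x: "5773/10000 \<le> cfrac (1 ## l)" "cfrac (1 ## l) \<le> 7322/10000" using cfrac_1_bounds[OF w(1)] cfrac_bounds[of "1 ## l"] w by auto
  have y: "0 \<le> cfrac (2 ## ?r)" "cfrac (2 ## ?r) \<le> 4227/10000" using cfrac_2_bounds[OF w(2)] cfrac_bounds[of "2 ## ?r"] w by auto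
  have "cfrac (replicate (Suc m) 2 @- (2 ## ?r)) - cfrac (replicate (Suc m) 2 @- (1 ## l)) < excess N (42/100) (42/100)"
    using gap_bound[OF C'] by simp
  then have "twos (Suc m) (cfrac (2 ## ?r)) - twos (Suc m) (cfrac (1 ## l)) < excess N (42/100) (42/100)"
    using w cfrac_twos[of "2 ## ?r" "Suc m"] cfrac_twos[of "1 ## l" "Suc m"] by simp
  moreover have "excess N (42/100) (42/100) \<le> \<bar>twos (Suc m) (cfrac (1 ## l)) - twos (Suc m) (cfrac (2 ## ?r))\<bar>"
    by (rule excess_le_twos_gap[OF N m(2) x y])
  moreover have "twos (Suc m) (cfrac (1 ## l)) \<le> twos (Suc m) (cfrac (2 ## ?r))"
    by (rule twos_mono(2)) (use x y m in auto)
  ultimately show False by linarith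
qed

lemma no_121:
  assumes C: "C (1 ## l) (2 ## 1 ## r)"
  shows False
proof -
  have "l \<in> words12" using words'[OF C] by simp
  then show False
  proof (cases rule: words12_cases)
    case (1 l')
    then show False using no_even_gap[of 0 l' r] C N by simp
  next
    case (2 l')
    then show False using no_212 C by blast
  qed
qed

text \<open>The block on the left would be odd and shorter, so the descent ends at the forbidden $121$.\<close>

lemma no_odd_block:
  assumes "C (1 ## l) (replicate a 2 @- (1 ## r))" "odd a" "a < N"
  shows False
  using assms
proof (induction a arbitrary: l r rule: less_induct)
  case (less a)
  note C = less.prems(1)
  obtain a' where a': "a = Suc a'" using less.prems(2) by (cases a) auto
  show False
  proof (cases "a' = 0")
    case True
    then show False using C no_121 by (simp add: a')
  next
    case False
    have "l \<in> words12" using words'[OF C] by simp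
    then show False
    proof (cases rule: words12_cases)
      case (2 l')
      then show False using no_212 C by (simp add: a')
    next
      case (1 l')
      from 1(2) show False
      proof (cases rule: words12_twos_cases[where n = a'])
        case (2 s')
        then show False using no_even_gap[of a' s' r] C 1 less.prems by (simp add: a')
      next
        case (1 d s')
        have C1: "C (1 ## 1 ## (replicate d 2 @- (1 ## s'))) (replicate a 2 @- (1 ## r))"
          using C 1 \<open>l = 1 ## l'\<close> by simp
        show False
        proof (cases "even d")
          case True
          \<comment> \<open>Parity: a is odd and d even with d < a - 1, hence d + 3 \<le> a.\<close>
          then show False using no_odd_gap[OF C1] 1 less.prems a' by (auto elim!: evenE oddE)
        next
          case False
          have "C (replicate d 2 @- (1 ## s')) (1 ## 1 ## (replicate a 2 @- (1 ## r)))"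
            using C1 move' by blast
          then have "C (1 ## s') (replicate d 2 @- (1 ## 1 ## (replicate a 2 @- (1 ## r))))"
            by (simp add: move_twos)
          then show False
            using less.IH[of d s' "1 ## (replicate a 2 @- (1 ## r))"] False 1(1) less.prems(3) a' by simp
        qed
      qed
    qed
  qed
qed

text \<open>Beside a run of at least three twos, a single 1 is impossible by \<open>no_212\<close>
  and three ones by \<open>no_odd_gap\<close> with m = 0, which is why the run must have length
  3.\<close>

lemma run_11:
  assumes C: "C (1 ## r) (replicate b 2 @- l)" and b: "3 \<le> b"
  obtains r' where "r = 1 ## 2 ## r'" "r' \<in> words12"
proof -
  obtain b' where b': "b = Suc b'" using b by (cases b) auto
  have "r \<in> words12" using words'[OF C] by simp
  then show ?thesis
  proof (cases rule: words12_cases)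
    case (2 r')
    then show ?thesis using no_212[of r' "replicate b' 2 @- l"] C by (simp add: b')
  next
    case (1 r')
    from 1(2) show ?thesis
    proof (cases rule: words12_cases)
      case (1 r'')
      then show ?thesis using no_odd_gap[of 0 r'' b l] C \<open>r = 1 ## r'\<close> b N by simp
    next
      case (2 r'')
      then show ?thesis using that \<open>r = 1 ## r'\<close> by blast
    qed
  qed
qed

text \<open>A shorter block would have odd length, or even length d \<le> N - 2; in the latter case
  the given block has at least d + 3 twos, contrary to \<open>no_odd_gap\<close>.\<close>

lemma after_long_block:
  assumes C: "C (1 ## 1 ## r) (replicate b 2 @- l)" and b: "N < b"
  obtains r' where "r = replicate N 2 @- r'" "r' \<in> words12"
proof -
  have "r \<in> words12" using words'[OF C] by simp
  then show ?thesis
  proof (cases rule: words12_twos_cases[where n = N])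
    case (1 d s')
    show ?thesis
    proof (cases "even d")
      case True
      then have "Suc d < N" using 1(1) N by (auto elim!: evenE)
      then show ?thesis using no_odd_gap[of d s' b l] C 1 True b by auto
    next
      case False
      have "C (replicate d 2 @- (1 ## s')) (1 ## 1 ## (replicate b 2 @- l))"
        using C 1 move' by blast
      then have "C (1 ## s') (replicate d 2 @- (1 ## 1 ## (replicate b 2 @- l)))"
        by (simp add: move_twos)
      then show ?thesis using no_odd_block 1(1) False by blast
    qed
  next
    case 2
    then show ?thesis using that by blast
  qed
qed

text \<open>The words to compare, 2 1 1 ... and 2 1 2 ..., differ behind a 1, so blocks of twos do
  not help; direct bounds give a gap of at least 0.3796 - 0.37, more than 0.0082. This forces the
  fourth 1 of form (1).\<close>

lemma no_2_111_2211:
  assumes C: "C (1 ## 1 ## 1 ## 2 ## l) (2 ## 2 ## 1 ## 1 ## r)"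
  shows False
proof -
  have w: "l \<in> words12" "r \<in> words12" using words[OF C] words'[OF C] by auto
  have "cfrac (1 ## 1 ## r) \<le> 6341/10000"
    using cfrac_bounds[OF w(2)] w by (simp add: cfrac_11 ext_11_eq divide_simps)
  then have 1: "3796/10000 \<le> cfrac (2 ## 1 ## 1 ## r)"
    using cfrac_bounds1[of "1 ## 1 ## r"] w by (simp add: cfrac_Stream[of "1 ## 1 ## r"] divide_simps)
  have 2: "cfrac (2 ## 1 ## 2 ## l) \<le> 37/100"
    using cfrac_12_ge[OF w(1)] w by (simp add: cfrac_Stream[of "1 ## 2 ## l"] divide_simps)
  show False using gap_bound[OF C] 1 2 excess_upper[OF N] by simp
qed


lemma gap_less: "C (1 ## 1 ## l) (2 ## r) \<Longrightarrow> gap l r < excess N (42/100) (42/100)"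
  using gap_bound by (simp add: gap_def)

lemma sym_iff: "C l r \<longleftrightarrow> C r l"
  using sym by blast

lemma move_iff: "C (a ## l) r \<longleftrightarrow> C l (a ## r)"
  using move move' by blast

section \<open>Classification\<close>

text \<open>Common prefix exactly \<open>2_N\<close>, then 1 on the right and 2 on the left: the
  case in which the gap has the size of the reference values. The right side is fixed by the long
  block before it. On the left a further 2 would make the gap too small, by
  \<open>twos_long_gap\<close>.\<close>

lemma middle_case:
  assumes C: "C (1 ## 1 ## (replicate N 2 @- b)) (2 ## (replicate N 2 @- (1 ## a)))"
    and big: "excess N (4187/10000) (4187/10000) < gap (replicate N 2 @- b) (replicate N 2 @- (1 ## a))"
  obtains a' b' where "a = 1 ## (replicate N 2 @- a')" "b = 1 ## 1 ## b'" "a' \<in> words12" "b' \<in> words12"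
    "gap (replicate N 2 @- b) (replicate N 2 @- (1 ## a)) = twos N (ext_11 (twos N (cfrac a'))) - twos N (ext_211 (cfrac b'))"
proof -
  have C1: "C (1 ## a) (replicate (Suc N) 2 @- (1 ## 1 ## (replicate N 2 @- b)))"
    using C by (subst sym_iff) (simp add: move_iff move_twos Stream_replicate[symmetric])
  have wb: "b \<in> words12" using words'[OF C] by simp
  obtain a1 where a1: "a = 1 ## 2 ## a1" "a1 \<in> words12"
    using run_11[OF C1] N by auto
  have eq: "gap (replicate N 2 @- b) (replicate N 2 @- (1 ## a)) = twos N (cfrac (1 ## 1 ## 2 ## a1)) - twos N (cfrac (2 ## b))"
    using a1 wb cfrac_twos[of "2 ## b" N] cfrac_twos[of "1 ## 1 ## 2 ## a1" N] by (simp add: gap_def Stream_replicate)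
  from wb obtain b1 where b1: "b = 1 ## b1" "b1 \<in> words12"
  proof (cases rule: words12_cases)
    case (2 b1)
    have "twos N (cfrac (1 ## 1 ## 2 ## a1)) - twos N (cfrac (2 ## 2 ## b1)) \<le> excess N (4187/10000) (4187/10000)"
      using cfrac_112_le[OF a1(2)] cfrac_22_ge[OF 2(2)] cfrac_bounds[of "1 ## 1 ## 2 ## a1"] a1
      by (intro twos_long_gap N) auto
    then show ?thesis using big eq 2 by simp
  qed
  obtain n where n: "N = Suc n" using N by (cases N) auto
  have C2: "C (1 ## b1) (replicate N 2 @- (1 ## 1 ## 2 ## (replicate N 2 @- (1 ## a))))"
    using C a1 b1 by (simp add: move_iff move_twos Stream_replicate[symmetric])
  from b1(2) obtain b' where b': "b1 = 1 ## b'" "b' \<in> words12"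
  proof (cases rule: words12_cases)
    case (2 b2)
    then show ?thesis using no_212[of b2 "replicate n 2 @- (1 ## 1 ## 2 ## (replicate N 2 @- (1 ## a)))"] C2
      unfolding n by simp
  qed
  have C3: "C (1 ## 1 ## (2 ## a1)) (replicate (Suc N) 2 @- (1 ## 1 ## (replicate N 2 @- b)))"
    using C1 a1 by simp
  obtain a' where a': "2 ## a1 = replicate N 2 @- a'" "a' \<in> words12"
    using after_long_block[OF C3] by auto
  have "cfrac (1 ## 1 ## 2 ## a1) = ext_11 (twos N (cfrac a'))"
    using cfrac_11(1)[of "2 ## a1"] a1 a' cfrac_twos[of a' N] by simp
  moreover have "cfrac (2 ## b) = ext_211 (cfrac b')" using b1 b' cfrac_211[of b'] by simp
  ultimately show ?thesis using that[of a' b'] a1 a' b1 b' eq by simp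
qed

text \<open>Only two blocks of length $2k+2$ around the centre keep $\lambda$ between
  $m(\theta(\underline{\omega}_k))$ and $\mu_k$. The tightest case is $k = 1$ with \<open>a = 2 1 1 2 2 \<dots>\<close> and
  \<open>b = 2 2 1 1 1 1 \<dots>\<close>, which needs the explicit evaluation in \<open>excess_numeric_2\<close>.\<close>

lemma inner_blocks:
  assumes C: "C (1 ## 1 ## (replicate N 2 @- (1 ## 1 ## b))) (2 ## (replicate N 2 @- (1 ## 1 ## (replicate N 2 @- a))))"
    (is "C ?l ?r")
    and w: "a \<in> words12" "b \<in> words12"
    and big: "excess N (4187/10000) (4187/10000) < twos N (ext_11 (twos N (cfrac a))) - twos N (ext_211 (cfrac b))"
    and small: "twos N (ext_11 (twos N (cfrac a))) - twos N (ext_211 (cfrac b)) < excess N (42/100) (42/100)"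
  obtains a' b' where "a = 2 ## 2 ## 1 ## 1 ## 2 ## a'" "b = replicate N 2 @- (2 ## 2 ## 1 ## 1 ## 2 ## b')"
    "a' \<in> words12" "b' \<in> words12"
proof -
  note small_big = small big
  \<comment> \<open>The cut is moved just behind the twos at the start of a, respectively of b, so
    that the lemmas on runs and blocks apply there; for a the word is also reversed.\<close>
  have right: "C (1 ## z) (replicate j 2 @- (replicate N 2 @- (1 ## 1 ## 2 ## (replicate N 2 @- (1 ## 1 ## (replicate N 2 @- (1 ## 1 ## b)))))))"
    if "a = replicate j 2 @- (1 ## z)" for j z
    using C that by (subst sym_iff) (simp add: move_iff move_twos Stream_replicate[symmetric])
  have left: "C (1 ## z) (replicate j 2 @- (1 ## 1 ## (replicate N 2 @- (1 ## 1 ## 2 ## (replicate N 2 @- (1 ## 1 ## (replicate N 2 @- a)))))))"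
    if "b = replicate j 2 @- (1 ## z)" for j z
    using C that by (simp add: move_iff move_twos Stream_replicate[symmetric])
  have right_run: "\<exists>t. z = 1 ## 2 ## t \<and> t \<in> words12" if "a = replicate j 2 @- (1 ## z)" "1 \<le> j" for j z
    using right[OF that(1)] that(2) N by (elim run_11[where b = "j + N", unfolded replicate_shift_add]) auto
  have left_run: "\<exists>t. z = 1 ## 2 ## t \<and> t \<in> words12" if "b = replicate j 2 @- (1 ## z)" "3 \<le> j" for j z
    using run_11[OF left[OF that(1)] that(2)] by blast
  have x21: "\<exists>t. z = 1 ## 2 ## t \<and> t \<in> words12" if "a = 2 ## 1 ## z" for z
    using right_run[of 1 z] that by (simp add: One_nat_def)
  have x221: "\<exists>t. z = 1 ## 2 ## t \<and> t \<in> words12" if "a = 2 ## 2 ## 1 ## z" for z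
    using right_run[of 2 z] that by (simp add: numeral_2_eq_2)
  \<comment> \<open>The smallest remaining case is a = 2 1 1 2 ..., with value at least 1/2.5873; 2
    1 2 and 2 1 1 1 cannot follow the block \<open>2_N\<close>.\<close>
  have x_ge: "38/100 \<le> cfrac a"
    using w(1)
  proof (cases rule: words12_cases)
    case (1 z)
    then show ?thesis using cfrac_1_bounds[of z] by simp
  next
    case (2 z)
    from 2(2) show ?thesis
    proof (cases rule: words12_cases)
      case (1 z')
      then obtain t where t: "z' = 1 ## 2 ## t" "t \<in> words12" using x21 2 by blast
      then show ?thesis using 1 2 cfrac_112_le[of t] cfrac_bounds1[of "1 ## 1 ## 2 ## t"]
        by (simp add: cfrac_Stream[of "1 ## 1 ## 2 ## t"] divide_simps)
    next
      case (2 z')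
      then show ?thesis using \<open>a = 2 ## z\<close> cfrac_22_ge[of z'] by simp
    qed
  qed
  obtain b' where b': "b = replicate N 2 @- b'" "b' \<in> words12"
    using w(2)
  proof (cases rule: words12_twos_cases[where n = N])
    case (1 d s)
    have False
    proof (cases "even d")
      case False
      then show False using no_odd_block left[OF 1(2)] 1(1) by blast
    next
      case True
      \<comment> \<open>If the block on the left ends early, at even length d, the 1 behind it has
        value above 1/2, more than any continuation by twos. So b is worth at least
        \<open>twos N 1\<close>, which explains the argument 1 in the third inequality of
        \<open>excess_numeric\<close>.\<close>
      have "twos N 1 = twos d (twos (N - d) 1)" using 1(1) by (simp add: twos_add[symmetric])
      also have "\<dots> \<le> twos d (cfrac (1 ## s))"
      proof (intro twos_mono(1) True twos_nonneg)
        obtain e where e: "N - d = Suc e" using 1(1) by (metis Suc_diff_Suc)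
        have "twos (Suc e) 1 \<le> 1/2" using twos_nonneg[of 1 e] by (simp add: field_simps)
        then show "twos (N - d) 1 \<le> cfrac (1 ## s)" using cfrac_1_bounds[OF 1(3)] unfolding e by linarith
      qed simp
      also have "\<dots> = cfrac b" using 1 by (simp add: cfrac_twos)
      finally have "twos N (ext_211 (cfrac b)) \<le> twos N (ext_211 (twos N 1))"
        using N cfrac_bounds1[OF w(2)] by (intro twos_mono(1) ext_211_antimono ext_211_nonneg twos_nonneg) auto
      moreover have "twos N (ext_11 (twos N (38/100))) \<le> twos N (ext_11 (twos N (cfrac a)))"
        using N x_ge by (intro twos_mono(1) ext_11_mono ext_11_nonneg twos_nonneg) auto
      ultimately have "excess N (38/100) 1 \<le> twos N (ext_11 (twos N (cfrac a))) - twos N (ext_211 (cfrac b))"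
        by (simp add: excess_def)
      then show False using small excess_numeric(3)[OF N] by simp
    qed
    then show ?thesis ..
  next
    case (2 s)
    then show ?thesis using that by blast
  qed
  define x y where "x = cfrac a" and "y = cfrac b'"
  have small: "excess N x y < excess N (42/100) (42/100)" and big: "excess N (4187/10000) (4187/10000) < excess N x y"
    using small_big b' cfrac_twos[of b' N] by (simp_all add: excess_def x_def y_def)
  have xy: "3658/10000 \<le> x" "x \<le> 7322/10000" "3658/10000 \<le> y" "y \<le> 7322/10000"
    using cfrac_bounds w b' by (auto simp: x_def y_def)
  have not_above: False if "u \<le> x" "v \<le> y" "0 \<le> u" "0 \<le> v" "excess N (42/100) (42/100) < excess N u v" for u v
    using excess_mono[of N u x v y] N that small by auto
  have not_below: False if "x \<le> u" "y \<le> v" "excess N u v < excess N (4187/10000) (4187/10000)" for u v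
    using excess_mono[of N x u y v] N that big xy by auto
  have b'_run: "\<exists>t. z = 1 ## 2 ## t \<and> t \<in> words12" if "b' = replicate j 2 @- (1 ## z)" "3 \<le> N + j" for j z
    using left_run[of "N + j" z] that b' by (simp add: replicate_shift_add)
  have b'_1: "\<exists>z'. z = 1 ## z' \<and> z' \<in> words12" if "b' = 1 ## z" for z
  proof -
    have "z \<in> words12" using that b' by simp
    then show ?thesis
    proof (cases rule: words12_cases)
      case (2 z')
      obtain n where n: "N = Suc n" using N by (cases N) auto
      have "C (1 ## z) (replicate N 2 @- (1 ## 1 ## (replicate N 2 @- (1 ## 1 ## 2 ## (replicate N 2 @- (1 ## 1 ## (replicate N 2 @- a)))))))"
        using left[of N z] b' that by simp
      then show ?thesis using no_212[of z'] 2 unfolding n by simp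
    qed blast
  qed
  from w(1) show ?thesis
  proof (cases rule: words12_cases)
    case (1 z)
    then have "5773/10000 \<le> x" using cfrac_1_bounds[of z] by (simp add: x_def)
    then show ?thesis using not_above[of "5773/10000" "36/100"] excess_numeric(1)[OF N] xy by simp
  next
    case a2: (2 z)
    from a2(2) show ?thesis
    proof (cases rule: words12_cases)
      case a21: (1 z1)
      then obtain t where t: "z1 = 1 ## 2 ## t" "t \<in> words12" using x21 a2 by blast
      have x: "x \<le> 38801/100000" using cfrac_21_le[of z1] a2 a21 by (simp add: x_def)
      show ?thesis
      proof (cases "y \<le> 5873/10000")
        case True
        then show ?thesis using not_below x excess_numeric(4)[OF N] by blast
      next
        case False
        from b'(2) obtain s where s: "b' = 1 ## s" "s \<in> words12"
        proof (cases rule: words12_cases)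
          case (2 s)
          then show ?thesis using cfrac_2_bounds[of s] False by (simp add: y_def)
        qed
        then obtain s1 where s1: "s = 1 ## s1" "s1 \<in> words12" using b'_1 by blast
        from s1(2) obtain s2 where s2: "s1 = 1 ## s2" "s2 \<in> words12"
        proof (cases rule: words12_cases)
          case (2 s2)
          then show ?thesis using cfrac_112_le[of s2] False s s1 by (simp add: y_def)
        qed
        \<comment> \<open>Three ones next to a block of N \<ge> 3 twos contradict
          \<open>run_11\<close>, so only k = 1 is left.\<close>
        have "\<not> 3 \<le> N" using b'_run[of 0 s] s s1 s2 by auto
        then have N2: "N = 2" using N by auto
        from s2(2) obtain s3 where s3: "s2 = 1 ## s3" "s3 \<in> words12"
        proof (cases rule: words12_cases)
          case (2 s3)
          have "C (1 ## s) (replicate 2 2 @- (1 ## 1 ## (replicate 2 2 @- (1 ## 1 ## 2 ## (replicate 2 2 @- (1 ## 1 ## (replicate 2 2 @- a)))))))"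
            using left[of N s] b' s unfolding N2 by simp
          then have "C (1 ## 1 ## 1 ## 2 ## s3) (2 ## 2 ## 1 ## 1 ## (replicate 2 2 @- (1 ## 1 ## 2 ## (replicate 2 2 @- (1 ## 1 ## (replicate 2 2 @- a))))))"
            using s1 s2 2 by (simp add: numeral_2_eq_2)
          then show ?thesis using no_2_111_2211 by blast
        qed
        \<comment> \<open>The bound for words beginning with 1 1 1 1; the 0.38677 below is the one
          for 2 1 1 2 2.\<close>
        have "y \<le> 62036/100000"
          using cfrac_1_bounds[OF s3(2)] cfrac_bounds1[of "1 ## s3"] s3 s s1 s2
          by (simp add: y_def cfrac_11 ext_11_eq cfrac_Stream[of "1 ## s3"] divide_simps)
        moreover from t(2) have "x \<le> 38677/100000"
        proof (cases rule: words12_cases)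
          case (1 t')
          have "C (1 ## z1) (replicate 1 2 @- (replicate N 2 @- (1 ## 1 ## 2 ## (replicate N 2 @- (1 ## 1 ## (replicate N 2 @- (1 ## 1 ## b)))))))"
            using right[of 1 z1] a2 a21 by (simp add: One_nat_def)
          then have "C (1 ## 1 ## (replicate 3 2 @- (1 ## 1 ## 2 ## (replicate N 2 @- (1 ## 1 ## (replicate N 2 @- (1 ## 1 ## b))))))) (2 ## 1 ## t')"
            using t 1 unfolding N2 by (subst sym_iff) (simp add: move_iff numeral_2_eq_2 numeral_3_eq_3 One_nat_def)
          then show ?thesis using no_121 by blast
        next
          case (2 t')
          have "585537/1000000 \<le> cfrac (1 ## 1 ## 2 ## 2 ## t')"
            using cfrac_2_bounds[OF 2(2)] cfrac_bounds1[of "2 ## t'"] 2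
            by (simp add: cfrac_11 ext_11_eq cfrac_Stream[of "2 ## t'"] divide_simps)
          then show ?thesis
            using cfrac_bounds1[of "1 ## 1 ## 2 ## 2 ## t'"] a2 a21 t 2
            by (simp add: x_def cfrac_Stream[of "1 ## 1 ## 2 ## 2 ## t'"] divide_simps)
        qed
        ultimately show ?thesis using not_below excess_numeric_2 unfolding N2 by blast
      qed
    next
      case a22: (2 z1)
      have x_ge: "4127/10000 \<le> x" using cfrac_22_ge[of z1] a2 a22 by (simp add: x_def)
      from b'(2) obtain s where s: "b' = 2 ## s" "s \<in> words12"
      proof (cases rule: words12_cases)
        case (1 s)
        then have "577/1000 \<le> y" using cfrac_1_bounds[of s] by (simp add: y_def)
        then show ?thesis using not_above[of "4127/10000" "577/1000"] x_ge excess_numeric(2)[OF N] by simp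
      qed
      \<comment> \<open>Among the words beginning with 2 only those beginning with 2 2 1 1 2 exceed
        0.4146. The same dichotomy holds for a, which now begins with 2 2, and the fifth and sixth
        inequalities of \<open>excess_numeric\<close> require the larger alternative on both
        sides.\<close>
      have y_le: "y \<le> 41903/100000 \<and> (y \<le> 4146/10000 \<or> (\<exists>s'. b' = 2 ## 2 ## 1 ## 1 ## 2 ## s' \<and> s' \<in> words12))"
        using s(2)
      proof (cases rule: words12_cases)
        case (1 s1)
        then show ?thesis using cfrac_21_le[of s1] s by (simp add: y_def)
      next
        case (2 s1)
        from 2(2) show ?thesis
        proof (cases rule: words12_cases)
          case (2 s2)
          then show ?thesis using cfrac_222_le[of s2] s \<open>s = 2 ## s1\<close> by (simp add: y_def)
        next
          case (1 s2)
          then obtain s' where "s2 = 1 ## 2 ## s'" "s' \<in> words12"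
            using b'_run[of 2 s2] s \<open>s = 2 ## s1\<close> N by (auto simp: numeral_2_eq_2)
          then show ?thesis using 1 cfrac_22_11_range(2)[of s'] s \<open>s = 2 ## s1\<close> by (simp add: y_def)
        qed
      qed
      from a22(2) show ?thesis
      proof (cases rule: words12_cases)
        case (2 z2)
        then have "x \<le> 4146/10000" using cfrac_222_le[of z2] a2 a22 by (simp add: x_def)
        then show ?thesis using not_below y_le excess_numeric(6)[OF N] by blast
      next
        case (1 z2)
        then obtain a' where a': "a = 2 ## 2 ## 1 ## 1 ## 2 ## a'" "a' \<in> words12" using x221 a2 a22 by blast
        then have "x \<le> 41903/100000" using cfrac_22_11_range[of a'] by (simp add: x_def)
        then have "\<not> y \<le> 4146/10000" using not_below excess_numeric(5)[OF N] by blast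
        then show ?thesis using y_le a' b' that by blast
      qed
    qed
  qed
qed


text \<open>Here e is \<lambda> - 3 of the periodic word at its star, where the right tail x0 begins
  with 1. For the last letter of form (2) the reference 0.4187 is too coarse and e itself is needed:
  a tail beginning with 2 would put the gap below e.\<close>

lemma form2_of_middle_case:
  assumes C: "C (1 ## 1 ## (replicate N 2 @- b)) (2 ## (replicate N 2 @- (1 ## a)))"
    and e: "e < gap (replicate N 2 @- b) (replicate N 2 @- (1 ## a))" "excess N (4187/10000) (4187/10000) \<le> e"
    and e_def: "e = excess N (ext_2211 (twos N x0)) (ext_2211 (twos N y0))"
    and x0: "5773/10000 \<le> x0" "x0 \<le> 7322/10000" and y0: "36/100 \<le> y0" "y0 \<le> 7322/10000"
  shows "form2 k (1 ## (replicate N 2 @- b)) (replicate N 2 @- (1 ## a))"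
proof -
  obtain a1 b1 where ab: "a = 1 ## (replicate N 2 @- a1)" "b = 1 ## 1 ## b1" "a1 \<in> words12" "b1 \<in> words12"
    and eq: "gap (replicate N 2 @- b) (replicate N 2 @- (1 ## a)) = twos N (ext_11 (twos N (cfrac a1))) - twos N (ext_211 (cfrac b1))"
    by (rule middle_case[OF C]) (use e in auto)
  have C1: "C (1 ## 1 ## (replicate N 2 @- (1 ## 1 ## b1))) (2 ## (replicate N 2 @- (1 ## 1 ## (replicate N 2 @- a1))))"
    using C ab by simp
  have "gap (replicate N 2 @- b) (replicate N 2 @- (1 ## a)) < excess N (42/100) (42/100)"
    by (rule gap_less[OF C])
  then obtain a2 b2 where ab2: "a1 = 2 ## 2 ## 1 ## 1 ## 2 ## a2" "b1 = replicate N 2 @- (2 ## 2 ## 1 ## 1 ## 2 ## b2)"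
    "a2 \<in> words12" "b2 \<in> words12"
    using inner_blocks[OF C1 ab(3,4)] e eq by auto
  have Ca: "C (1 ## 1 ## (2 ## a2)) (replicate (Suc (Suc N)) 2 @- (1 ## 1 ## 2 ## (replicate N 2 @- (1 ## 1 ## (replicate N 2 @- (1 ## 1 ## b1))))))"
    using C1 ab2 by (subst sym_iff) (simp add: move_iff move_twos Stream_replicate[symmetric])
  have Cb: "C (1 ## 1 ## (2 ## b2)) (replicate (Suc (Suc N)) 2 @- (1 ## 1 ## (replicate N 2 @- (1 ## 1 ## 2 ## (replicate N 2 @- (1 ## 1 ## (replicate N 2 @- a1)))))))"
    using C1 ab2 by (simp add: move_iff move_twos Stream_replicate[symmetric])
  obtain a3 where a3: "2 ## a2 = replicate N 2 @- a3" "a3 \<in> words12" using after_long_block[OF Ca] by auto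
  obtain b3 where b3: "2 ## b2 = replicate N 2 @- b3" "b3 \<in> words12" using after_long_block[OF Cb] by auto
  have fa: "cfrac a1 = ext_2211 (twos N (cfrac a3))"
    using ab2 a3 cfrac_2211[of "2 ## a2"] cfrac_twos[of a3 N] by simp
  have fb: "cfrac b1 = twos N (ext_2211 (twos N (cfrac b3)))"
    using ab2 b3 cfrac_2211[of "2 ## b2"] cfrac_twos[of b3 N] cfrac_twos[of "2 ## 2 ## 1 ## 1 ## 2 ## b2" N] by simp
  have gap_eq: "gap (replicate N 2 @- b) (replicate N 2 @- (1 ## a)) = excess N (ext_2211 (twos N (cfrac a3))) (ext_2211 (twos N (cfrac b3)))"
    by (simp add: eq fa fb excess_def)
  obtain r where r: "a3 = 1 ## r"
    using a3(2)
  proof (cases rule: words12_cases)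
    case (2 z)
    have "excess N (ext_2211 (twos N (cfrac a3))) (ext_2211 (twos N (cfrac b3))) < excess N (ext_2211 (twos N x0)) (ext_2211 (twos N y0))"
      using cfrac_2_bounds[OF 2(2)] cfrac_bounds[OF a3(2)] cfrac_bounds[OF b3(2)] 2 x0 y0
      by (intro excess_tail_less N) auto
    then show ?thesis using e gap_eq e_def by simp
  qed (use that in blast)
  show ?thesis
    unfolding form2_def
  proof (intro exI conjI)
    show "1 ## (replicate N 2 @- b) = 1 ## (replicate N 2 @- (1 ## 1 ## (replicate (N + 2) 2 @- (1 ## 1 ## (replicate N 2 @- b3)))))"
      using ab ab2 b3 by (simp add: Stream_replicate[symmetric])
    show "replicate N 2 @- (1 ## a) = replicate N 2 @- (1 ## 1 ## (replicate (N + 2) 2 @- (1 ## 1 ## (replicate N 2 @- (1 ## r)))))"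
      using ab ab2 a3 r by (simp add: Stream_replicate[symmetric])
  qed
qed

text \<open>When both runs end together, the block to the left of the star has p - 1 twos. This
  number must be even, so p = 2m + 1, and p \<le> 2k gives m < k. The final \<open>2_2\<close> is
  due to the absence of 121.\<close>

lemma form3_of_tie:
  assumes C: "C (1 ## 1 ## \<beta>) (2 ## \<alpha>)" and p: "2 \<le> p" "p \<le> N"
    and \<alpha>: "\<alpha> = replicate p 2 @- (1 ## a)" and \<beta>: "2 ## \<beta> = replicate p 2 @- (1 ## b)"
  shows "form3 k (1 ## \<beta>) \<alpha>"
proof -
  obtain q where q: "p = Suc q" using p by (cases p) auto
  have \<beta>': "\<beta> = replicate q 2 @- (1 ## b)" using \<beta> q by simp
  have Cb: "C (1 ## b) (replicate q 2 @- (1 ## 1 ## 2 ## \<alpha>))"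
    using C \<beta>' by (simp add: move_iff move_twos)
  have Ca: "C (1 ## a) (replicate (Suc p) 2 @- (1 ## 1 ## \<beta>))"
    using C \<alpha> by (subst sym_iff) (simp add: move_iff move_twos Stream_replicate[symmetric])
  have "even q" using no_odd_block[OF Cb] p q by auto
  then obtain m where m: "q = 2 * m" by (elim evenE)
  have m1: "1 \<le> m" "m < k" using p q m by auto
  have "b \<in> words12" using words'[OF Cb] by simp
  then obtain l where l: "b = 1 ## l"
  proof (cases rule: words12_cases)
    case (2 z)
    obtain q' where "q = Suc q'" using m m1 not0_implies_Suc[of q] by auto
    then show ?thesis using no_212[of z "replicate q' 2 @- (1 ## 1 ## 2 ## \<alpha>)"] Cb 2 by simp
  qed (use that in blast)
  obtain a1 where a1: "a = 1 ## 2 ## a1" "a1 \<in> words12"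
    using run_11[OF Ca] p by auto
  from a1(2) obtain r where r: "a1 = 2 ## r"
  proof (cases rule: words12_cases)
    case (1 z)
    have "C (1 ## 1 ## (replicate (Suc p) 2 @- (1 ## 1 ## \<beta>))) (2 ## 1 ## z)"
      using Ca a1 1 by (subst sym_iff) (simp add: move_iff)
    then show ?thesis using no_121 by blast
  qed (use that in blast)
  show ?thesis unfolding form3_def
    by (rule exI[of _ m], rule exI[of _ l], rule exI[of _ r])
      (use m1 m \<beta>' \<alpha> q a1 r l in \<open>simp add: Suc_eq_plus1[symmetric] del: Suc_eq_plus1\<close>)
qed

text \<open>Everything depends on which of \<alpha> and \<open>2 ## \<beta>\<close> has the shorter
  initial run of twos, and on the parity of its length p. A tie gives form (3), a shorter run on the
  right gives form (2) with p = N, and a shorter run on the left is impossible. Form (1) arises when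
  \<alpha> begins with 2 1.\<close>

lemma classification:
  assumes C: "C (1 ## L) (2 ## \<alpha>)"
    and e: "e < cfrac \<alpha> + cfrac (1 ## L) - 1" "excess N (4187/10000) (4187/10000) \<le> e"
    and e_def: "e = excess N (ext_2211 (twos N x0)) (ext_2211 (twos N y0))"
    and x0: "5773/10000 \<le> x0" "x0 \<le> 7322/10000" and y0: "36/100 \<le> y0" "y0 \<le> 7322/10000"
  shows "form1 L \<alpha> \<or> form2 k L \<alpha> \<or> form3 k L \<alpha>"
proof -
  have w: "L \<in> words12" "\<alpha> \<in> words12" using words[OF C] words'[OF C] by auto
  from w(1) obtain \<beta> where L: "L = 1 ## \<beta>" "\<beta> \<in> words12"
    by (cases rule: words12_cases) (use no_212 C in blast)+
  note C = C[unfolded L(1)]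
  have gap: "e < gap \<beta> \<alpha>" using e(1) L cfrac_11(2)[of \<beta>] by (simp add: gap_def)
  have e0: "0 < e" using e(2) excess_pos[OF N] by simp
  from w(2) obtain \<alpha>1 where \<alpha>1: "\<alpha> = 2 ## \<alpha>1" "\<alpha>1 \<in> words12"
    by (cases rule: words12_cases) (use no_even_gap[of 0 \<beta>] C N in auto)
  from \<alpha>1(2) show ?thesis
  proof (cases rule: words12_cases)
    case a: (1 a)
    from a(2) obtain a' where a': "a = 1 ## a'" "a' \<in> words12"
    proof (cases rule: words12_cases)
      case (2 z)
      have "C (1 ## 2 ## z) (2 ## 2 ## 1 ## 1 ## \<beta>)"
        using C \<alpha>1 a 2 by (subst sym_iff) (simp add: move_iff)
      then show ?thesis using no_212 by blast
    qed (use that in blast)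
    from L(2) show ?thesis
    proof (cases rule: words12_cases)
      case (2 b)
      have "cfrac \<alpha> \<le> cfrac (2 ## \<beta>)"
        using cfrac_21_le[of a] cfrac_22_ge[of b] 2 a \<alpha>1 by simp
      then show ?thesis using gap e0 by (simp add: gap_def)
    next
      case b: (1 b)
      from b(2) show ?thesis
      proof (cases rule: words12_cases)
        case (1 b')
        then show ?thesis using L b a a' \<alpha>1 by (auto simp: form1_def)
      next
        case (2 b')
        then show ?thesis using no_2_111_2211[of b' a'] C L b a a' \<alpha>1 by simp
      qed
    qed
  next
    case a: (2 a)
    from L(2) show ?thesis
    proof (cases rule: words12_cases)
      case (1 b)
      then show ?thesis using no_odd_gap[of 0 b 3 a] C L a \<alpha>1 N by (simp add: numeral_3_eq_3)
    next
      case b: (2 b)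
      have w2: "2 ## \<beta> \<in> words12" using L by simp
      have tie: ?thesis if "p \<le> N" "\<alpha> = replicate p 2 @- (1 ## a')" "2 ## \<beta> = replicate p 2 @- (1 ## b')" for p a' b'
      proof -
        have "p \<noteq> 0" using that(2) \<alpha>1 by (intro notI) simp
        moreover have "p \<noteq> Suc 0" using that(2) \<alpha>1 a by (intro notI) simp
        ultimately have "2 \<le> p" by linarith
        then show ?thesis using form3_of_tie[OF C _ that] L by simp
      qed
      have left_longer: ?thesis if p: "p \<le> N" "\<alpha> = replicate p 2 @- (1 ## a')" "2 ## \<beta> = replicate p 2 @- (2 ## b')" "a' \<in> words12" "b' \<in> words12" for p a' b'
      proof -
        have \<beta>: "\<beta> = replicate p 2 @- b'" using p(3) by (simp add: Stream_replicate[symmetric])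
        \<comment> \<open>An odd prefix makes the gap negative, an even one shorter than N makes it
          too large.\<close>
        consider "odd p" | "even p" "p < N" | "p = N" using p(1) by linarith
        then show ?thesis
        proof cases
          case 1
          have "gap \<beta> \<alpha> = twos p (cfrac (1 ## a')) - twos p (cfrac (2 ## b'))"
            by (rule gap_common_prefix[OF p(2,3)]) (use p in auto)
          also have "\<dots> \<le> 0"
            using twos_mono(2)[of "cfrac (2 ## b')" "cfrac (1 ## a')" p] 1 p cfrac_bounds1[of "2 ## b'"]
              cfrac_1_bounds[of a'] cfrac_2_bounds[of b'] by simp
          finally show ?thesis using gap e0 by simp
        next
          case 2
          then show ?thesis using no_even_gap[of p b' a'] C \<beta> p by simp
        next
          case 3
          have "form2 k L \<alpha>"
            using form2_of_middle_case[of b' a', OF _ _ e(2) e_def x0 y0] C gap \<beta> p L unfolding 3 by simp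
          then show ?thesis by simp
        qed
      qed
      have right_longer: ?thesis if p: "p \<le> N" "\<alpha> = replicate p 2 @- (2 ## a')" "2 ## \<beta> = replicate p 2 @- (1 ## b')" "a' \<in> words12" "b' \<in> words12" for p a' b'
      proof (cases "even p")
        case True
        have "gap \<beta> \<alpha> = twos p (cfrac (2 ## a')) - twos p (cfrac (1 ## b'))"
          by (rule gap_common_prefix[OF p(2,3)]) (use p in auto)
        also have "\<dots> \<le> 0"
          using twos_mono(1)[of "cfrac (2 ## a')" "cfrac (1 ## b')" p] True p cfrac_bounds1[of "2 ## a'"]
            cfrac_1_bounds[of b'] cfrac_2_bounds[of a'] by simp
        finally show ?thesis using gap e0 by simp
      next
        case False
        then obtain q where q: "p = Suc q" "even q" by (cases p) auto
        have "\<beta> = replicate q 2 @- (1 ## b')" using p(3) q by simp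
        moreover have "2 ## \<alpha> = replicate (q + 3) 2 @- a'" using p(2) q
          by (simp add: numeral_3_eq_3 Stream_replicate[symmetric])
        moreover have "Suc q < N" using p(1) q N False by (metis le_neq_implies_less)
        ultimately show ?thesis using no_odd_gap[of q b' "q + 3" a'] C q by simp
      qed
      from w(2) show ?thesis
      proof (cases rule: words12_twos_cases[where n = "Suc N"])
        case A: (1 p a')
        from w2 show ?thesis
        proof (cases rule: words12_twos_cases[where n = p])
          case B: (1 q b')
          obtain c where "p = q + Suc c" using B(1) less_imp_Suc_add by auto
          then have "\<alpha> = replicate q 2 @- (2 ## (replicate c 2 @- (1 ## a')))"
            using A(2) by (simp only: replicate_shift_add replicate_Suc shift.simps)
          then show ?thesis using right_longer[of q "replicate c 2 @- (1 ## a')" b'] A B by simp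
        next
          case B: (2 s)
          from B(2) show ?thesis
          proof (cases rule: words12_cases)
            case (1 b')
            then show ?thesis using tie[of p a' b'] A B by simp
          next
            case (2 b')
            then show ?thesis using left_longer[of p a' b'] A B by simp
          qed
        qed
      next
        case A: (2 a')
        from w2 show ?thesis
        proof (cases rule: words12_twos_cases[where n = "Suc N"])
          case B: (1 q b')
          obtain c where "Suc N = q + Suc c" using B(1) less_imp_Suc_add by auto
          then have "\<alpha> = replicate q 2 @- (2 ## (replicate c 2 @- a'))"
            using A(1) by (simp only: replicate_shift_add replicate_Suc shift.simps)
          then show ?thesis using right_longer[of q "replicate c 2 @- a'" b'] A B by simp
        next
          case B: (2 b')
          \<comment> \<open>A common prefix longer than N pushes the gap down to the lower
            reference, hence to at most e.\<close>
          have "gap \<beta> \<alpha> = twos (Suc N) (cfrac a') - twos (Suc N) (cfrac b')"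
            by (rule gap_common_prefix[OF A(1) B(1) A(2) B(2)])
          also have "\<dots> \<le> excess N (4187/10000) (4187/10000)"
            using twos_gap_le_excess[OF N, of "Suc N" "cfrac a'" "cfrac b'"] cfrac_bounds[OF A(2)] cfrac_bounds[OF B(2)]
            by (simp del: twos.simps)
          finally show ?thesis using gap e(2) by simp
        qed
      qed
    qed
  qed
qed

end

section \<open>Bi-infinite words\<close>

definition right_of :: "(int \<Rightarrow> nat) \<Rightarrow> int \<Rightarrow> nat stream" where
  "right_of \<theta> i = smap (\<lambda>n. \<theta> (i + int n)) nats"

definition left_of :: "(int \<Rightarrow> nat) \<Rightarrow> int \<Rightarrow> nat stream" where
  "left_of \<theta> i = smap (\<lambda>n. \<theta> (i - int n)) nats"

lemma snth_nats: "nats !! n = n"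
  by (induction n) auto

lemma snth_right_of [simp]: "right_of \<theta> i !! n = \<theta> (i + int n)"
  by (simp add: right_of_def snth_nats del: snth_siterate)

lemma snth_left_of [simp]: "left_of \<theta> i !! n = \<theta> (i - int n)"
  by (simp add: left_of_def snth_nats del: snth_siterate)

lemma stream_eq_snth: "s = t \<longleftrightarrow> (\<forall>n. s !! n = t !! n)"
  by (metis stream_smap_nats ext)

lemma right_of_unfold: "right_of \<theta> i = \<theta> i ## right_of \<theta> (i + 1)"
proof -
  have "right_of \<theta> i !! n = (\<theta> i ## right_of \<theta> (i + 1)) !! n" for n
  proof (cases n)
    case 0
    then show ?thesis using snth_right_of[of \<theta> i 0] by (simp del: snth_right_of)
  next
    case (Suc m)
    then show ?thesis using snth_right_of[of \<theta> i "Suc m"] snth_right_of[of \<theta> "i + 1" m]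
      by (simp add: algebra_simps del: snth_right_of)
  qed
  then show ?thesis by (simp add: stream_eq_snth)
qed

lemma left_of_unfold: "left_of \<theta> i = \<theta> i ## left_of \<theta> (i - 1)"
proof -
  have "left_of \<theta> i !! n = (\<theta> i ## left_of \<theta> (i - 1)) !! n" for n
  proof (cases n)
    case 0
    then show ?thesis using snth_left_of[of \<theta> i 0] by (simp del: snth_left_of)
  next
    case (Suc m)
    then show ?thesis using snth_left_of[of \<theta> i "Suc m"] snth_left_of[of \<theta> "i - 1" m]
      by (simp add: algebra_simps del: snth_left_of)
  qed
  then show ?thesis by (simp add: stream_eq_snth)
qed

lemma words12_of:
  assumes "range \<theta> \<subseteq> {1, 2}"
  shows "right_of \<theta> i \<in> words12" "left_of \<theta> i \<in> words12"
  using assms by (auto simp: words12_def streams_iff_snth)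

lemma lambda_at_eq:
  assumes "range \<theta> \<subseteq> {1, 2}"
  shows "lambda_at i \<theta> = real (\<theta> i) + cfrac (left_of \<theta> (i - 1)) + cfrac (right_of \<theta> (i + 1))"
proof -
  have "snth (right_of \<theta> (i + 1)) = (\<lambda>n. \<theta> (i + int (Suc n)))"
    "snth (left_of \<theta> (i - 1)) = (\<lambda>n. \<theta> (i - int (Suc n)))"
    by (auto simp: algebra_simps)
  moreover have "cf (\<lambda>n. \<theta> (i + int n)) = real (\<theta> (i + int 0)) + 1 / cf (\<lambda>n. \<theta> (i + int (Suc n)))"
    by (rule cf_unfold) (use assms in auto)
  moreover have "cf (\<lambda>n. if n = 0 then 0 else \<theta> (i - int n)) =
      real (if (0::nat) = 0 then 0 else \<theta> (i - int 0)) + 1 / cf (\<lambda>n. if Suc n = 0 then 0 else \<theta> (i - int (Suc n)))"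
    by (rule cf_unfold) (use assms in auto)
  ultimately show ?thesis by (simp add: lambda_at_def cfrac_def)
qed

lemma right_of_append:
  assumes "right_of \<theta> i = w @- r"
  shows "right_of \<theta> (i + int (length w)) = r"
    and "left_of \<theta> (i + int (length w) - 1) = rev w @- left_of \<theta> (i - 1)"
  using assms
proof (induction w arbitrary: i)
  case (Cons a w)
  {
    case 1
    then have "right_of \<theta> (i + 1) = w @- r" using right_of_unfold[of \<theta> i] by simp
    from Cons(1)[OF this] show ?case by (simp add: algebra_simps)
  next
    case 2
    then have *: "\<theta> i = a" "right_of \<theta> (i + 1) = w @- r" using right_of_unfold[of \<theta> i] by auto
    from Cons(2)[OF *(2)] show ?case using left_of_unfold[of \<theta> i] *(1) by (simp add: algebra_simps)
  }
qed auto

lemma has_form_iff: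
  "has_form u v \<theta> \<longleftrightarrow> (\<exists>l r. left_of \<theta> (-1) = rev u @- l \<and> right_of \<theta> 0 = v @- r)"
proof
  assume h: "has_form u v \<theta>"
  have "left_of \<theta> (-1) !! n = (rev u @- left_of \<theta> (-1 - int (length u))) !! n" for n
  proof (cases "n < length u")
    case True
    then have "\<theta> (int (length u - Suc n) - int (length u)) = (u @ v) ! (length u - Suc n)"
      using h[unfolded has_form_def, rule_format, of "length u - Suc n"] by simp
    moreover have "int (length u - Suc n) - int (length u) = - 1 - int n" using True by linarith
    ultimately show ?thesis using True by (simp add: rev_nth nth_append)
  qed (simp add: of_nat_diff)
  moreover have "right_of \<theta> 0 !! n = (v @- right_of \<theta> (int (length v))) !! n" for n
  proof (cases "n < length v")
    case True
    then have "\<theta> (int (length u + n) - int (length u)) = (u @ v) ! (length u + n)"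
      using h[unfolded has_form_def, rule_format, of "length u + n"] by simp
    then show ?thesis using True by simp
  qed (simp add: of_nat_diff)
  ultimately show "\<exists>l r. left_of \<theta> (-1) = rev u @- l \<and> right_of \<theta> 0 = v @- r"
    unfolding stream_eq_snth by blast
next
  assume "\<exists>l r. left_of \<theta> (-1) = rev u @- l \<and> right_of \<theta> 0 = v @- r"
  then obtain l r where lr: "left_of \<theta> (-1) = rev u @- l" "right_of \<theta> 0 = v @- r" by blast
  show "has_form u v \<theta>"
    unfolding has_form_def
  proof (intro allI impI)
    fix i assume i: "i < length (u @ v)"
    show "\<theta> (int i - int (length u)) = (u @ v) ! i"
    proof (cases "i < length u")
      case True
      then have "left_of \<theta> (-1) !! (length u - Suc i) = u ! i"
        by (simp add: lr rev_nth Suc_diff_Suc)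
      moreover have "- 1 - int (length u - Suc i) = int i - int (length u)" using True by linarith
      ultimately show ?thesis using True by (simp add: nth_append)
    next
      case False
      have "right_of \<theta> 0 !! (i - length u) = v ! (i - length u)"
        using False i by (simp add: lr)
      then show ?thesis using False by (simp add: nth_append of_nat_diff)
    qed
  qed
qed

lemma right_of_transposition: "right_of (transposition \<theta>) i = left_of \<theta> (- i)"
  by (simp add: stream_eq_snth transposition_def)

lemma left_of_transposition: "left_of (transposition \<theta>) i = right_of \<theta> (- i)"
  by (simp add: stream_eq_snth transposition_def)

lemma lambda_at_transposition:
  assumes "range \<theta> \<subseteq> {1, 2}"
  shows "lambda_at i (transposition \<theta>) = lambda_at (- i) \<theta>"
proof -
  have "range (transposition \<theta>) \<subseteq> {1, 2}" using assms by (auto simp: transposition_def)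
  then show ?thesis using assms
    by (simp add: lambda_at_eq right_of_transposition left_of_transposition)
      (simp add: transposition_def algebra_simps)
qed

lemma lambda_at_le_markov:
  assumes "range \<theta> \<subseteq> {1, 2}"
  shows "lambda_at i \<theta> \<le> markov \<theta>"
  unfolding markov_def
proof (rule cSUP_upper)
  have "lambda_at j \<theta> \<le> 4" for j
  proof -
    have "\<theta> j \<in> {1, 2}" using assms by blast
    then show ?thesis
      using cfrac_bounds1[OF words12_of(1)[OF assms, of "j + 1"]] cfrac_bounds1[OF words12_of(2)[OF assms, of "j - 1"]]
      by (auto simp: lambda_at_eq[OF assms])
  qed
  then show "bdd_above (range (\<lambda>i. lambda_at i \<theta>))" by (intro bdd_aboveI) auto
qed simp

definition cut :: "(int \<Rightarrow> nat) \<Rightarrow> nat stream \<Rightarrow> nat stream \<Rightarrow> bool" where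
  "cut \<theta> l r \<longleftrightarrow> (\<exists>i. l = left_of \<theta> (i - 1) \<and> r = right_of \<theta> i \<or> r = left_of \<theta> (i - 1) \<and> l = right_of \<theta> i)"

lemma near_three_cut:
  assumes k: "1 \<le> k" and r: "range \<theta> \<subseteq> {1, 2}"
    and less: "\<And>i. lambda_at i \<theta> < 3 + excess (2 * k) (42/100) (42/100)"
  shows "near_three k (cut \<theta>)"
proof
  show "cut \<theta> r l" if "cut \<theta> l r" for l r using that by (auto simp: cut_def)
  show "r \<in> words12" if "cut \<theta> l r" for l r using that words12_of[OF r] by (auto simp: cut_def)
  have *: "\<exists>i. l = left_of \<theta> (i - 1) \<and> a = \<theta> i \<and> r = right_of \<theta> (i + 1) \<or>
      r = left_of \<theta> (i - 1) \<and> a = \<theta> i \<and> l = right_of \<theta> (i + 1)" if "cut \<theta> l (a ## r)" for l a r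
  proof -
    from that obtain i where "l = left_of \<theta> (i - 1) \<and> a ## r = right_of \<theta> i \<or> a ## r = left_of \<theta> (i - 1) \<and> l = right_of \<theta> i"
      by (auto simp: cut_def)
    then show ?thesis
    proof
      assume "l = left_of \<theta> (i - 1) \<and> a ## r = right_of \<theta> i"
      then show ?thesis using right_of_unfold[of \<theta> i] by auto
    next
      assume "a ## r = left_of \<theta> (i - 1) \<and> l = right_of \<theta> i"
      then show ?thesis using left_of_unfold[of \<theta> "i - 1"] by (intro exI[of _ "i - 1"]) auto
    qed
  qed
  show "cut \<theta> (a ## l) r" if c: "cut \<theta> l (a ## r)" for l a r
  proof -
    from *[OF c] obtain i where "l = left_of \<theta> (i - 1) \<and> a = \<theta> i \<and> r = right_of \<theta> (i + 1) \<or>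
      r = left_of \<theta> (i - 1) \<and> a = \<theta> i \<and> l = right_of \<theta> (i + 1)" by blast
    then show ?thesis
    proof
      assume "l = left_of \<theta> (i - 1) \<and> a = \<theta> i \<and> r = right_of \<theta> (i + 1)"
      then show ?thesis using left_of_unfold[of \<theta> i] unfolding cut_def by (intro exI[of _ "i + 1"]) auto
    next
      assume "r = left_of \<theta> (i - 1) \<and> a = \<theta> i \<and> l = right_of \<theta> (i + 1)"
      then show ?thesis using right_of_unfold[of \<theta> i] unfolding cut_def by (intro exI[of _ i]) auto
    qed
  qed
  show "real a + cfrac l + cfrac r < 3 + excess (2 * k) (42/100) (42/100)" if c: "cut \<theta> l (a ## r)" for l a r
    using *[OF c] less by (auto simp: lambda_at_eq[OF r] algebra_simps)
qed (fact k)

section \<open>The periodic word and a lower bound for its Markov value\<close>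

lemma range_periodic_omega: "range (periodic (omega k)) \<subseteq> {1, 2}"
proof -
  have "0 < length (omega k)" by (simp add: omega_def)
  then have "nat (i mod int (length (omega k))) < length (omega k)" for i
    by (simp add: nat_less_iff)
  then have "periodic (omega k) i \<in> set (omega k)" for i by (simp add: periodic_def)
  moreover have "set (omega k) \<subseteq> {1, 2}" by (auto simp: omega_def)
  ultimately show ?thesis by blast
qed

lemma range_gamma1: "range (gamma1 k) \<subseteq> {1, 2}"
  using range_periodic_omega[of k] by (auto simp: gamma1_def)

lemma right_of_take:
  assumes "\<And>t. t < length w \<Longrightarrow> \<theta> (i + int t) = w ! t"
  shows "right_of \<theta> i = w @- right_of \<theta> (i + int (length w))"
  using assms by (simp add: stream_eq_snth shift_snth of_nat_diff)

text \<open>What precedes a copy of \<open>omega k\<close>, read leftwards. It is the same before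
  every copy, in the periodic word and in \<open>gamma1\<close>.\<close>

abbreviation past :: "nat \<Rightarrow> nat stream" where
  "past k \<equiv> left_of (periodic (omega k)) (-1)"

lemma periodic_omega_nth:
  "t < length (omega k) \<Longrightarrow> periodic (omega k) (j * int (length (omega k)) + int t) = omega k ! t"
  by (simp add: periodic_def)

lemma replicate_2: "replicate 2 a = [a, a]"
  by (simp add: numeral_2_eq_2)

lemma replicate_plus_1: "replicate (n + 1) a @- s = a ## (replicate n a @- s)"
  by (simp add: One_nat_def)

lemma omega_shift:
  "omega k @- s = replicate (2 * k) 2 @- (1 ## 1 ## (replicate (2 * k + 1) 2 @- (1 ## 1 ## (replicate (2 * k + 2) 2 @- (1 ## 1 ## s)))))"
  by (simp only: omega_def replicate_2 shift_append shift.simps)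

lemma rev_omega_shift:
  "rev (omega k) @- s = 1 ## 1 ## (replicate (2 * k + 2) 2 @- (1 ## 1 ## (replicate (2 * k + 1) 2 @- (1 ## 1 ## (replicate (2 * k) 2 @- s)))))"
  by (simp only: omega_def rev_append rev_replicate replicate_2 append_assoc shift_append shift.simps
      rev.simps append.simps)

lemma past_unfold: "past k = rev (omega k) @- past k"
proof -
  define L where "L = length (omega k)"
  have "right_of (periodic (omega k)) 0 = omega k @- right_of (periodic (omega k)) (0 + int L)"
    unfolding L_def using periodic_omega_nth[of _ k 0] by (intro right_of_take) simp
  from right_of_append(2)[OF this] have "left_of (periodic (omega k)) (int L - 1) = rev (omega k) @- past k"
    by (simp add: L_def)
  moreover have "left_of (periodic (omega k)) (int L - 1) = past k"
  proof -
    have "periodic (omega k) (int L - 1 - int n) = periodic (omega k) (-1 - int n)" for n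
      using mod_add_self2[of "-1 - int n" "int L"] by (simp add: periodic_def L_def algebra_simps)
    then show ?thesis by (simp add: stream_eq_snth)
  qed
  ultimately show ?thesis by simp
qed

lemma past_words12: "past k \<in> words12"
  by (rule words12_of[OF range_periodic_omega])

text \<open>The supremum is bounded below by its value at one position, the first letter of
  \<open>2_(2k+1)\<close>. There the surroundings have the shape of \<open>excess\<close>, with 2 2
  1 1 behind both outer blocks. Then x begins with 1, because the next block on the right is exactly
  \<open>2_(2k)\<close>, and y begins with 2, because the one on the left is
  \<open>2_(2k+1)\<close>.\<close>

lemma markov_periodic_omega:
  assumes "1 \<le> k"
  obtains x y where "5773/10000 \<le> x" "x \<le> 7322/10000" "36/100 \<le> y" "y \<le> 7322/10000"
    "3 + excess (2 * k) (ext_2211 (twos (2 * k) x)) (ext_2211 (twos (2 * k) y)) \<le> markov (periodic (omega k))"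
proof -
  define \<theta> where "\<theta> = periodic (omega k)"
  define N where "N = 2 * k"
  define P where "P = right_of \<theta> 0"
  have r: "range \<theta> \<subseteq> {1, 2}" unfolding \<theta>_def by (rule range_periodic_omega)
  have Pw: "P \<in> words12" unfolding P_def by (rule words12_of[OF r])
  have "right_of \<theta> 0 = omega k @- right_of \<theta> (0 + int (length (omega k)))"
    unfolding \<theta>_def using periodic_omega_nth[of _ k 0] by (intro right_of_take) simp
  moreover have "right_of \<theta> (0 + int (length (omega k))) = P"
    by (simp add: stream_eq_snth P_def \<theta>_def periodic_def)
  ultimately have P: "right_of \<theta> 0 = omega k @- P" "P = omega k @- P" by (simp_all add: P_def)
  define w where "w = replicate N 2 @ [1, 1::nat]"
  have "right_of \<theta> 0 = w @- (replicate (N + 1) 2 @- (1 ## 1 ## (replicate (N + 2) 2 @- (1 ## 1 ## P))))"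
    unfolding P(1) omega_shift by (simp add: w_def N_def)
  from right_of_append[OF this] have
    R: "right_of \<theta> (int (length w)) = 2 ## (replicate N 2 @- (1 ## 1 ## (replicate N 2 @- (2 ## 2 ## 1 ## 1 ## P))))" and
    L: "left_of \<theta> (int (length w) - 1) = 1 ## 1 ## (replicate N 2 @- past k)"
    by (simp_all add: w_def \<theta>_def Stream_replicate[symmetric] replicate_plus_1)
  have "lambda_at (int (length w)) \<theta> = 2 + cfrac (1 ## 1 ## (replicate N 2 @- past k))
     + cfrac (replicate N 2 @- (1 ## 1 ## (replicate N 2 @- (2 ## 2 ## 1 ## 1 ## P))))"
    using R L right_of_unfold[of \<theta> "int (length w)"] by (simp add: lambda_at_eq[OF r])
  also have "cfrac (1 ## 1 ## (replicate N 2 @- past k)) = 1 - cfrac (replicate N 2 @- (2 ## past k))"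
    using past_words12 by (simp add: cfrac_11(2) Stream_replicate)
  also have "cfrac (replicate N 2 @- (1 ## 1 ## (replicate N 2 @- (2 ## 2 ## 1 ## 1 ## P)))) =
      twos N (ext_11 (twos N (ext_2211 (cfrac P))))"
    using Pw by (simp add: cfrac_twos cfrac_11(1) cfrac_2211)
  also have "cfrac P = cfrac (omega k @- P)" by (rule arg_cong[OF P(2)])
  also have "\<dots> = twos N (cfrac (1 ## 1 ## (replicate (N + 1) 2 @- (1 ## 1 ## (replicate (N + 2) 2 @- (1 ## 1 ## P))))))"
    (is "_ = twos N ?x") unfolding omega_shift using Pw by (simp add: cfrac_twos N_def)
  also have "cfrac (replicate N 2 @- (2 ## past k)) =
      twos N (ext_211 (twos N (ext_2211 (twos N (cfrac (2 ## 1 ## 1 ## (replicate N 2 @- past k)))))))" (is "_ = twos N (ext_211 (twos N (ext_2211 (twos N ?y))))")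
  proof -
    have e: "2 ## past k = 2 ## 1 ## 1 ## (replicate N 2 @- (2 ## 2 ## 1 ## 1 ## (replicate N 2 @- (2 ## 1 ## 1 ## (replicate N 2 @- past k)))))"
      by (subst past_unfold) (simp add: rev_omega_shift N_def Stream_replicate[symmetric] replicate_plus_1)
    show ?thesis
      unfolding e using past_words12 by (simp add: cfrac_twos cfrac_211 cfrac_2211)
  qed
  finally have "lambda_at (int (length w)) \<theta> = 3 + excess N (ext_2211 (twos N ?x)) (ext_2211 (twos N ?y))"
    by (simp add: excess_def)
  moreover have "lambda_at (int (length w)) \<theta> \<le> markov \<theta>" by (rule lambda_at_le_markov[OF r])
  moreover have "5773/10000 \<le> ?x" "?x \<le> 7322/10000" "36/100 \<le> ?y" "?y \<le> 7322/10000"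
    using Pw past_words12 cfrac_1_bounds[of "1 ## (replicate (N + 1) 2 @- (1 ## 1 ## (replicate (N + 2) 2 @- (1 ## 1 ## P))))"]
      cfrac_bounds[of "1 ## 1 ## (replicate (N + 1) 2 @- (1 ## 1 ## (replicate (N + 2) 2 @- (1 ## 1 ## P))))"]
      cfrac_bounds[of "2 ## 1 ## 1 ## (replicate N 2 @- past k)"] by auto
  ultimately show ?thesis using that[of ?x ?y] by (simp add: \<theta>_def N_def)
qed

section \<open>The Markov value of gamma1\<close>

text \<open>The bound \<lambda> \<le> B at all letters of w, placed between l (read leftwards) and
  r. In this form estimates for blocks can be concatenated without index arithmetic.\<close>

primrec bounded_on :: "real \<Rightarrow> nat stream \<Rightarrow> nat list \<Rightarrow> nat stream \<Rightarrow> bool" where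
  "bounded_on B l [] r \<longleftrightarrow> True"
| "bounded_on B l (a # w) r \<longleftrightarrow> real a + cfrac l + cfrac (w @- r) \<le> B \<and> bounded_on B (a ## l) w r"

lemma bounded_on_append:
  "bounded_on B l (u @ w) r \<longleftrightarrow> bounded_on B l u (w @- r) \<and> bounded_on B (rev u @- l) w r"
  by (induction u arbitrary: l) auto

lemma lambda_at_bounded_on:
  assumes "range \<theta> \<subseteq> {1, 2}" "right_of \<theta> i = w @- r" "bounded_on B (left_of \<theta> (i - 1)) w r" "t < length w"
  shows "lambda_at (i + int t) \<theta> \<le> B"
  using assms(2-4)
proof (induction w arbitrary: i t)
  case (Cons a w)
  have *: "\<theta> i = a" "right_of \<theta> (i + 1) = w @- r"
    using Cons.prems(1) right_of_unfold[of \<theta> i] by auto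
  show ?case
  proof (cases t)
    case 0
    then show ?thesis using * Cons.prems(2) by (simp add: lambda_at_eq[OF assms(1)] algebra_simps)
  next
    case (Suc t')
    have "lambda_at (i + 1 + int t') \<theta> \<le> B"
      using Cons.prems Suc * left_of_unfold[of \<theta> i] by (intro Cons.IH) auto
    then show ?thesis by (simp add: Suc algebra_simps)
  qed
qed simp

lemma bounded_on_11:
  assumes "l \<in> words12" "r \<in> words12" "3 \<le> B"
  shows "bounded_on B l [1, 1] r"
  using cfrac_bounds[OF assms(1)] cfrac_bounds[OF assms(2)] cfrac_bounds[of "1 ## l"] cfrac_bounds[of "1 ## r"] assms
  by simp

lemma bounded_on_inner_twos:
  assumes "l \<in> words12" "r \<in> words12" "3 \<le> B"
  shows "bounded_on B (2 ## l) (replicate n 2) (2 ## r)"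
  using assms(1)
proof (induction n arbitrary: l)
  case (Suc n)
  have "cfrac (2 ## l) \<le> 4227/10000" "cfrac (2 ## (replicate n 2 @- r)) \<le> 4227/10000"
    using cfrac_2_bounds[OF Suc.prems] cfrac_2_bounds[of "replicate n 2 @- r"] assms by simp_all
  moreover have "bounded_on B (2 ## (2 ## l)) (replicate n 2) (2 ## r)"
    using Suc by simp
  ultimately show ?case using assms(3) by (simp add: Stream_replicate[symmetric])
qed simp

text \<open>Only the two end letters need a hypothesis: an inner 2 has twos on both sides, so
  \<lambda> \<le> 2 + 2 * 0.4227 < 3. At the last letter l and r change roles.\<close>

lemma bounded_on_block:
  assumes w: "l \<in> words12" "r \<in> words12" and B: "0 \<le> B" and n: "2 \<le> n"
    and first: "gap l (replicate (n - 1) 2 @- (1 ## 1 ## r)) \<le> B"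
    and last: "gap r (replicate (n - 1) 2 @- (1 ## 1 ## l)) \<le> B"
  shows "bounded_on (3 + B) (1 ## 1 ## l) (replicate n 2) (1 ## 1 ## r)"
proof -
  obtain m where m: "n = Suc (Suc m)" using le_Suc_ex[OF n] by auto
  have split: "replicate n (2::nat) = [2] @ replicate m 2 @ [2]"
    by (simp add: m replicate_append_same)
  have 1: "2 + cfrac (1 ## 1 ## l) + cfrac (replicate m 2 @- (2 ## 1 ## 1 ## r)) \<le> 3 + B"
    using first w by (simp add: gap_def cfrac_11(2) m Stream_replicate)
  have 2: "2 + cfrac (replicate m 2 @- (2 ## 1 ## 1 ## l)) + cfrac (1 ## 1 ## r) \<le> 3 + B"
    using last w by (simp add: gap_def cfrac_11(2) m Stream_replicate)
  have 3: "bounded_on (3 + B) (2 ## 1 ## 1 ## l) (replicate m 2) (2 ## 1 ## 1 ## r)"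
    by (rule bounded_on_inner_twos) (use w B in auto)
  show ?thesis unfolding split bounded_on_append using 1 2 3 by simp
qed

text \<open>The common prefix \<open>2_(n-1)\<close> is odd, and 1 follows on the right against 2 on
  the left.\<close>

lemma gap_short_block:
  assumes "even n" "2 \<le> n" "a \<in> words12" "b \<in> words12"
  shows "gap (replicate n 2 @- b) (replicate (n - 1) 2 @- (1 ## a)) \<le> 0"
proof -
  obtain m where m: "n = Suc m" using assms(2) by (cases n) auto
  have "gap (replicate n 2 @- b) (replicate (n - 1) 2 @- (1 ## a)) = twos m (cfrac (1 ## a)) - twos m (cfrac (2 ## 2 ## b))"
    using assms m by (intro gap_common_prefix) (auto simp: Stream_replicate[symmetric])
  also have "\<dots> \<le> 0"
    using twos_mono(2)[of "cfrac (2 ## 2 ## b)" "cfrac (1 ## a)" m] cfrac_bounds1[of "2 ## 2 ## b"]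
      cfrac_1_bounds[of a] cfrac_2_bounds[of "2 ## b"] assms m by simp
  finally show ?thesis .
qed

lemma gap_long_prefix:
  assumes "even n" "2 \<le> n" "a \<in> words12" "b \<in> words12"
  shows "gap (replicate n 2 @- b) (replicate (Suc n) 2 @- a) \<le> excess n (4187/10000) (4187/10000)"
proof -
  have "gap (replicate n 2 @- b) (replicate (Suc n) 2 @- a) = twos (Suc n) (cfrac a) - twos (Suc n) (cfrac b)"
    using assms by (intro gap_common_prefix) auto
  also have "\<dots> \<le> \<bar>twos (Suc n) (cfrac a) - twos (Suc n) (cfrac b)\<bar>" by simp
  also have "\<dots> \<le> excess n (4187/10000) (4187/10000)"
    using cfrac_bounds[OF assms(3)] cfrac_bounds[OF assms(4)] by (intro twos_gap_le_excess assms) auto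
  finally show ?thesis .
qed

text \<open>Leaving s arbitrary covers a further copy of \<open>omega k\<close> as well as the tail
  of twos, since both begin with \<open>2_(2k)\<close>. At the ends of \<open>2_(2k)\<close> the gap
  is negative and at those of \<open>2_(2k+2)\<close> the common prefix exceeds 2k. The largest
  bound is needed at the first letter of \<open>2_(2k+1)\<close>, where x and y are at most 0.41903;
  the last letter falls under \<open>twos_long_gap\<close>.\<close>

lemma bounded_on_omega:
  assumes k: "1 \<le> k" and s: "s \<in> words12"
  shows "bounded_on (3 + excess (2 * k) (4192/10000) (4192/10000)) (past k) (omega k) (replicate (2 * k) 2 @- s)"
proof -
  define N where "N = 2 * k"
  have N: "even N" "2 \<le> N" using k by (auto simp: N_def)
  define B where "B = excess N (4192/10000) (4192/10000)"
  have B0: "excess N (4187/10000) (4187/10000) \<le> B" unfolding B_def using N by (intro excess_mono) auto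
  have B: "0 \<le> B" using B0 excess_pos[OF N] by simp
  define p where "p = past k"
  have pw: "p \<in> words12" by (simp add: p_def past_words12)
  have p: "p = 1 ## 1 ## (replicate (N + 2) 2 @- (1 ## 1 ## (replicate (N + 1) 2 @- (1 ## 1 ## (replicate N 2 @- p)))))"
    using past_unfold[of k] unfolding rev_omega_shift p_def N_def .
  define p' where "p' = 1 ## 1 ## (replicate (N + 1) 2 @- (1 ## 1 ## (replicate N 2 @- p)))"
  have p_eq: "p = 1 ## 1 ## (replicate (N + 2) 2 @- p')" using p by (simp add: p'_def)
  have p'w: "p' \<in> words12" using pw by (simp add: p'_def del: replicate_Suc)
  define r where "r = replicate N 2 @- s"
  have rw: "r \<in> words12" using s by (simp add: r_def)
  have b1: "bounded_on (3 + B) p (replicate N 2)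
      (1 ## 1 ## (replicate (N + 1) 2 @- (1 ## 1 ## (replicate (N + 2) 2 @- (1 ## 1 ## r)))))"
  proof (subst p_eq, rule bounded_on_block)
    have "gap (replicate N 2 @- (2 ## 2 ## p')) (replicate (N - 1) 2 @- (1 ## 1 ## (replicate (N + 1) 2 @- (1 ## 1 ## (replicate (N + 2) 2 @- (1 ## 1 ## r)))))) \<le> 0"
      using p'w rw by (intro gap_short_block N) (simp_all)
    then show "gap (replicate (N + 2) 2 @- p') (replicate (N - 1) 2 @- (1 ## 1 ## (replicate (N + 1) 2 @- (1 ## 1 ## (replicate (N + 2) 2 @- (1 ## 1 ## r)))))) \<le> B"
      using B by (simp add: Stream_replicate[symmetric])
    have "gap (replicate N 2 @- (2 ## (1 ## 1 ## (replicate (N + 2) 2 @- (1 ## 1 ## r))))) (replicate (N - 1) 2 @- (1 ## 1 ## (replicate (N + 2) 2 @- p'))) \<le> 0"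
      using p'w rw by (intro gap_short_block N) (simp_all)
    then show "gap (replicate (N + 1) 2 @- (1 ## 1 ## (replicate (N + 2) 2 @- (1 ## 1 ## r)))) (replicate (N - 1) 2 @- (1 ## 1 ## (replicate (N + 2) 2 @- p'))) \<le> B"
      using B by (simp add: Stream_replicate[symmetric] replicate_plus_1)
  qed (use p'w rw B N in simp_all)
  have b2: "bounded_on (3 + B) (1 ## 1 ## (replicate N 2 @- p)) (replicate (N + 1) 2)
      (1 ## 1 ## (replicate (N + 2) 2 @- (1 ## 1 ## r)))"
  proof (rule bounded_on_block)
    define x where "x = cfrac (2 ## 2 ## 1 ## 1 ## r)"
    define y where "y = cfrac (2 ## 2 ## p')"
    obtain M where M: "N = Suc M" using N by (cases N) auto
    have "x \<le> 41903/100000"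
      using cfrac_22_11_range(2)[of "replicate M 2 @- s"] s by (simp add: x_def r_def M)
    moreover have "y \<le> 41903/100000"
      using cfrac_22_11_range(2)[of "replicate N 2 @- (1 ## 1 ## (replicate N 2 @- p))"] pw
      by (simp add: y_def p'_def replicate_plus_1)
    moreover have xy: "0 \<le> x" "0 \<le> y" using cfrac_bounds1[of "2 ## 2 ## 1 ## 1 ## r"] cfrac_bounds1[of "2 ## 2 ## p'"] rw p'w
      by (auto simp: x_def y_def)
    ultimately have *: "excess N x y \<le> B" unfolding B_def by (intro excess_mono N) auto
    have "gap (replicate N 2 @- p) (replicate N 2 @- (1 ## 1 ## (replicate (N + 2) 2 @- (1 ## 1 ## r))))
        = twos N (cfrac (1 ## 1 ## (replicate (N + 2) 2 @- (1 ## 1 ## r)))) - twos N (cfrac (2 ## p))"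
      using pw rw by (intro gap_common_prefix) (auto simp: Stream_replicate)
    also have "cfrac (1 ## 1 ## (replicate (N + 2) 2 @- (1 ## 1 ## r))) = ext_11 (twos N x)"
    proof -
      have e: "replicate (N + 2) 2 @- (1 ## 1 ## r) = replicate N 2 @- (2 ## 2 ## 1 ## 1 ## r)"
        by (simp add: Stream_replicate[symmetric])
      show ?thesis unfolding e x_def using rw by (simp add: cfrac_11(1) cfrac_twos)
    qed
    also have "cfrac (2 ## p) = ext_211 (twos N y)"
    proof -
      have e: "replicate (N + 2) 2 @- p' = replicate N 2 @- (2 ## 2 ## p')"
        by (simp add: Stream_replicate[symmetric])
      show ?thesis unfolding y_def p_eq e using p'w by (simp add: cfrac_211 cfrac_twos)
    qed
    finally show "gap (replicate N 2 @- p) (replicate (N + 1 - 1) 2 @- (1 ## 1 ## (replicate (N + 2) 2 @- (1 ## 1 ## r)))) \<le> B"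
      using * by (simp add: excess_def)
    have "gap (replicate (N + 2) 2 @- (1 ## 1 ## r)) (replicate N 2 @- (1 ## 1 ## (replicate N 2 @- p)))
        = twos N (cfrac (1 ## 1 ## (replicate N 2 @- p))) - twos N (cfrac (2 ## 2 ## 2 ## 1 ## 1 ## r))"
      using pw rw by (intro gap_common_prefix) (auto simp: Stream_replicate[symmetric])
    also have "\<dots> \<le> excess N (4187/10000) (4187/10000)"
    proof (rule twos_long_gap[OF N])
      show "cfrac (1 ## 1 ## (replicate N 2 @- p)) \<le> 5873/10000"
        using cfrac_112_le[of "replicate M 2 @- p"] pw by (simp add: M)
      show "0 \<le> cfrac (1 ## 1 ## (replicate N 2 @- p))"
        using cfrac_bounds1[of "1 ## 1 ## (replicate N 2 @- p)"] pw by simp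
      show "4127/10000 \<le> cfrac (2 ## 2 ## 2 ## 1 ## 1 ## r)"
        using cfrac_22_ge[of "2 ## 1 ## 1 ## r"] rw by simp
    qed
    finally show "gap (replicate (N + 2) 2 @- (1 ## 1 ## r)) (replicate (N + 1 - 1) 2 @- (1 ## 1 ## (replicate N 2 @- p))) \<le> B"
      using B0 by simp
  qed (use pw rw B N in simp_all)
  have b3: "bounded_on (3 + B) p' (replicate (N + 2) 2) (1 ## 1 ## r)"
    unfolding p'_def
  proof (rule bounded_on_block)
    have "gap (replicate N 2 @- (2 ## 1 ## 1 ## (replicate N 2 @- p))) (replicate (Suc N) 2 @- (1 ## 1 ## r)) \<le> B"
      using gap_long_prefix[OF N, of "1 ## 1 ## r" "2 ## 1 ## 1 ## (replicate N 2 @- p)"] pw rw B0 by simp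
    then show "gap (replicate (N + 1) 2 @- (1 ## 1 ## (replicate N 2 @- p))) (replicate (N + 2 - 1) 2 @- (1 ## 1 ## r)) \<le> B"
      by (simp add: Stream_replicate[symmetric] replicate_plus_1)
    have "gap r (replicate (Suc N) 2 @- (1 ## 1 ## (replicate (N + 1) 2 @- (1 ## 1 ## (replicate N 2 @- p))))) \<le> B"
      using gap_long_prefix[OF N, of "1 ## 1 ## (replicate (N + 1) 2 @- (1 ## 1 ## (replicate N 2 @- p)))" s] pw s B0
      by (simp add: r_def)
    then show "gap r (replicate (N + 2 - 1) 2 @- (1 ## 1 ## (replicate (N + 1) 2 @- (1 ## 1 ## (replicate N 2 @- p))))) \<le> B"
      by (simp add: replicate_plus_1)
  qed (use pw rw B N in simp_all)
  have ones: "bounded_on (3 + B) l [1, 1] r" if "l \<in> words12" "r \<in> words12" for l r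
    by (rule bounded_on_11) (use that B in auto)
  have rev_11: "rev [1, 1] = [1, 1 :: nat]" by simp
  have "bounded_on (3 + B) p (omega k) r"
    by (simp only: omega_def N_def[symmetric] replicate_2 bounded_on_append rev_replicate rev_11
        shift.simps shift_append p'_def[symmetric], intro conjI b1 b2 b3 ones) (use pw rw p'w in simp_all)
  then show ?thesis by (simp add: B_def p_def r_def N_def)
qed


lemma right_of_gamma1:
  assumes "j \<le> 1"
  shows "right_of (gamma1 k) (j * int (length (omega k))) =
    omega k @- right_of (gamma1 k) ((j + 1) * int (length (omega k)))"
proof -
  define L where "L = length (omega k)"
  have "right_of (gamma1 k) (j * int L) = omega k @- right_of (gamma1 k) (j * int L + int (length (omega k)))"
  proof (rule right_of_take)
    fix t assume t: "t < length (omega k)"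
    have "j * int L \<le> 1 * int L" using assms by (intro mult_right_mono) auto
    then have "j * int L + int t < 2 * int L" using t by (simp add: L_def)
    then show "gamma1 k (j * int L + int t) = omega k ! t"
      using periodic_omega_nth[OF t, of j] by (simp add: gamma1_def L_def)
  qed
  then show ?thesis by (simp add: L_def algebra_simps)
qed

lemma left_of_gamma1:
  assumes "j \<le> 2"
  shows "left_of (gamma1 k) (j * int (length (omega k)) - 1) = past k"
proof -
  define L where "L = length (omega k)"
  have "gamma1 k (j * int L - 1 - int n) = periodic (omega k) (- 1 - int n)" for n
  proof -
    have "j * int L \<le> 2 * int L" using assms by (intro mult_right_mono) auto
    then have "gamma1 k (j * int L - 1 - int n) = periodic (omega k) (j * int L - 1 - int n)"
      by (simp add: gamma1_def L_def)
    also have "\<dots> = periodic (omega k) (- 1 - int n)"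
      using mod_mult_self2[of "- 1 - int n" "int L" j] by (simp add: periodic_def L_def algebra_simps)
    finally show ?thesis .
  qed
  then show ?thesis by (simp add: stream_eq_snth L_def)
qed

lemma right_of_gamma1_twos:
  assumes "2 * int (length (omega k)) \<le> i"
  shows "right_of (gamma1 k) i = replicate n 2 @- right_of (gamma1 k) (i + int n)"
  using right_of_take[of "replicate n 2" "gamma1 k" i] assms by (simp add: gamma1_def)

text \<open>Beyond the copies of \<open>omega k\<close> only the first 2 of the tail is delicate.
  The block before it is \<open>2_(2k+2)\<close>, so the common prefix again exceeds 2k.\<close>

lemma lambda_at_gamma1_le:
  assumes k: "1 \<le> k"
  shows "lambda_at i (gamma1 k) \<le> 3 + excess (2 * k) (4192/10000) (4192/10000)"
proof -
  define L where "L = int (length (omega k))"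
  have L: "0 < L" by (simp add: L_def omega_def)
  note r = range_gamma1[of k]
  define N where "N = 2 * k"
  have N: "even N" "2 \<le> N" using k by (auto simp: N_def)
  define B where "B = excess N (4192/10000) (4192/10000)"
  have B0: "excess N (4187/10000) (4187/10000) \<le> B" unfolding B_def using N by (intro excess_mono) auto
  have B: "0 \<le> B" using B0 excess_pos[OF N] by simp
  consider "i < 2 * L" | "i = 2 * L" | "2 * L < i" by linarith
  then have "lambda_at i (gamma1 k) \<le> 3 + B"
  proof cases
    case 1
    define j where "j = i div L"
    define t where "t = nat (i mod L)"
    have t: "t < length (omega k)" "i = j * L + int t"
      using L by (auto simp: t_def j_def L_def nat_less_iff)
    have j: "j \<le> 1"
    proof (rule ccontr)
      assume "\<not> j \<le> 1"
      then have "2 * L \<le> j * L" using L by (intro mult_right_mono) auto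
      then show False using 1 t(2) by linarith
    qed
    obtain s where s: "right_of (gamma1 k) ((j + 1) * L) = replicate N 2 @- s" "s \<in> words12"
    proof (cases "j = 1")
      case True
      then show ?thesis using that[OF _ words12_of(1)[OF r]] right_of_gamma1_twos[of k "2 * L" N] by (simp add: L_def)
    next
      case False
      then have "j + 1 \<le> 1" using j by simp
      from right_of_gamma1[OF this, of k] show ?thesis
        using that words12_of(1)[OF r, of "(j + 1) * L"] by (simp add: L_def omega_shift N_def)
    qed
    have "lambda_at (j * L + int t) (gamma1 k) \<le> 3 + B"
    proof (rule lambda_at_bounded_on[OF r _ _ t(1)])
      show "right_of (gamma1 k) (j * L) = omega k @- (replicate N 2 @- s)"
        using right_of_gamma1[OF j, of k] s by (simp add: L_def)
      have "left_of (gamma1 k) (j * L - 1) = past k" using left_of_gamma1[of j k] j by (simp add: L_def)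
      then show "bounded_on (3 + B) (left_of (gamma1 k) (j * L - 1)) (omega k) (replicate N 2 @- s)"
        using bounded_on_omega[OF k s(2)] by (simp add: N_def B_def)
    qed
    then show ?thesis using t by simp
  next
    case 2
    have l: "left_of (gamma1 k) (i - 1) = past k" using left_of_gamma1[of 2 k] 2 by (simp add: L_def)
    define z where "z = right_of (gamma1 k) (i + 1 + int (Suc N))"
    have zw: "z \<in> words12" unfolding z_def by (rule words12_of[OF r])
    have rr: "right_of (gamma1 k) (i + 1) = replicate (Suc N) 2 @- z"
      unfolding z_def by (rule right_of_gamma1_twos) (use 2 in \<open>simp add: L_def\<close>)
    define p where "p = 1 ## 1 ## (replicate (2 * k + 1) 2 @- (1 ## 1 ## (replicate (2 * k) 2 @- past k)))"
    have pw: "p \<in> words12" using past_words12 by (simp add: p_def)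
    have past: "past k = 1 ## 1 ## (replicate N 2 @- (2 ## 2 ## p))"
      by (subst past_unfold) (simp add: rev_omega_shift p_def N_def Stream_replicate[symmetric])
    have "gap (replicate N 2 @- (2 ## 2 ## p)) (replicate (Suc N) 2 @- z) \<le> B"
      using gap_long_prefix[OF N, of z "2 ## 2 ## p"] pw zw B0 by simp
    moreover have "gamma1 k i = 2" using 2 by (simp add: gamma1_def L_def)
    ultimately show ?thesis
      using pw by (simp add: lambda_at_eq[OF r] l rr past cfrac_11(2) gap_def)
  next
    case 3
    have "gamma1 k i = 2" "gamma1 k (i - 1) = 2" "gamma1 k (i + 1) = 2" using 3 by (auto simp: gamma1_def L_def)
    then have "lambda_at i (gamma1 k) = 2 + cfrac (2 ## left_of (gamma1 k) (i - 2)) + cfrac (2 ## right_of (gamma1 k) (i + 2))"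
      using right_of_unfold[of "gamma1 k" "i + 1"] left_of_unfold[of "gamma1 k" "i - 1"] by (simp add: lambda_at_eq[OF r] add.commute)
    moreover have "cfrac (2 ## left_of (gamma1 k) (i - 2)) \<le> 4227/10000" "cfrac (2 ## right_of (gamma1 k) (i + 2)) \<le> 4227/10000"
      by (intro cfrac_2_bounds words12_of[OF r])+
    ultimately show ?thesis using B by simp
  qed
  then show ?thesis by (simp add: B_def N_def)
qed

lemma markov_gamma1_less:
  assumes "1 \<le> k"
  shows "markov (gamma1 k) < 3 + excess (2 * k) (42/100) (42/100)"
proof -
  have "markov (gamma1 k) \<le> 3 + excess (2 * k) (4192/10000) (4192/10000)"
    unfolding markov_def by (rule cSUP_least) (use lambda_at_gamma1_le[OF assms] in auto)
  also have "\<dots> < 3 + excess (2 * k) (42/100) (42/100)"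
    using excess_numeric(7)[of "2 * k"] assms by simp
  finally show ?thesis .
qed

section \<open>The theorem\<close>

lemma has_form_of_forms:
  assumes "left_of \<theta> (-1) = 1 ## L" "right_of \<theta> 0 = 2 ## \<alpha>"
  shows "form1 L \<alpha> \<Longrightarrow> has_form (replicate 4 1) ([2] @ [2] @ replicate 2 1) \<theta>"
    and "form2 k L \<alpha> \<Longrightarrow> has_form
           (replicate (2*k) 2 @ replicate 2 1 @ replicate (2*k+2) 2 @ replicate 2 1
              @ replicate (2*k) 2 @ replicate 2 1)
           ([2] @ replicate (2*k) 2 @ replicate 2 1 @ replicate (2*k+2) 2 @ replicate 2 1
              @ replicate (2*k) 2 @ [1]) \<theta>"
    and "form3 k L \<alpha> \<Longrightarrow> \<exists>m::nat. 1 \<le> m \<and> m < k \<and>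
            has_form
              (replicate 2 1 @ replicate (2*m) 2 @ replicate 2 1)
              ([2] @ replicate (2*m+1) 2 @ replicate 2 1 @ replicate 2 2) \<theta>"
proof -
  have r4: "replicate 4 (1::nat) = [1, 1, 1, 1]" 
    using replicate_add[of 2 2 "1::nat"] by (simp add: replicate_2)
  have rev_11: "rev [1, 1] = [1, 1 :: nat]" by simp
  have has_formI: "has_form u v \<theta>" if "1 ## L = rev u @- l" "2 ## \<alpha> = v @- r" for u v l r
    using that assms by (auto simp: has_form_iff)
  note simps = rev_append rev_replicate replicate_2 rev_11 append_assoc shift_append shift.simps
  show "has_form (replicate 4 1) ([2] @ [2] @ replicate 2 1) \<theta>" if "form1 L \<alpha>"
    using that unfolding form1_def
  proof (elim exE conjE)
    fix l r assume "L = 1 ## 1 ## 1 ## l" "\<alpha> = 2 ## 1 ## 1 ## r"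
    then show ?thesis by (intro has_formI[of _ l _ r]) (simp_all add: r4 replicate_2)
  qed
  show "has_form
           (replicate (2*k) 2 @ replicate 2 1 @ replicate (2*k+2) 2 @ replicate 2 1
              @ replicate (2*k) 2 @ replicate 2 1)
           ([2] @ replicate (2*k) 2 @ replicate 2 1 @ replicate (2*k+2) 2 @ replicate 2 1
              @ replicate (2*k) 2 @ [1]) \<theta>" if "form2 k L \<alpha>"
    using that unfolding form2_def
  proof (elim exE conjE)
    fix l r
    assume "L = 1 ## (replicate (2 * k) 2 @- (1 ## 1 ## (replicate (2 * k + 2) 2 @- (1 ## 1 ## (replicate (2 * k) 2 @- l)))))"
      "\<alpha> = replicate (2 * k) 2 @- (1 ## 1 ## (replicate (2 * k + 2) 2 @- (1 ## 1 ## (replicate (2 * k) 2 @- (1 ## r)))))"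
    then show ?thesis by (intro has_formI[of _ l _ r]) (simp_all only: simps)
  qed
  show "\<exists>m::nat. 1 \<le> m \<and> m < k \<and>
            has_form
              (replicate 2 1 @ replicate (2*m) 2 @ replicate 2 1)
              ([2] @ replicate (2*m+1) 2 @ replicate 2 1 @ replicate 2 2) \<theta>" if "form3 k L \<alpha>"
    using that unfolding form3_def
  proof (elim exE conjE)
    fix m l r assume m: "1 \<le> m" "m < k" and "L = 1 ## (replicate (2 * m) 2 @- (1 ## 1 ## l))"
      "\<alpha> = replicate (2 * m + 1) 2 @- (1 ## 1 ## 2 ## 2 ## r)"
    then have "has_form (replicate 2 1 @ replicate (2*m) 2 @ replicate 2 1)
        ([2] @ replicate (2*m+1) 2 @ replicate 2 1 @ replicate 2 2) \<theta>"
      by (intro has_formI[of _ l _ r]) (simp_all only: simps)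
    then show ?thesis using m by blast
  qed
qed

lemma forms_of_admissible:
  assumes k: "1 \<le> k" and r: "range \<theta> \<subseteq> {1, 2}"
    and less: "\<And>i. lambda_at i \<theta> < 3 + excess (2 * k) (42/100) (42/100)"
    and big: "markov (periodic (omega k)) < lambda_at 0 \<theta>"
    and \<theta>: "\<theta> 0 = 2" "\<theta> (-1) = 1"
  shows "form1 (left_of \<theta> (-2)) (right_of \<theta> 1) \<or> form2 k (left_of \<theta> (-2)) (right_of \<theta> 1)
    \<or> form3 k (left_of \<theta> (-2)) (right_of \<theta> 1)"
proof -
  interpret near_three k "cut \<theta>" by (rule near_three_cut[OF k r less])
  have l: "left_of \<theta> (-1) = 1 ## left_of \<theta> (-2)" and r0: "right_of \<theta> 0 = 2 ## right_of \<theta> 1"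
    using left_of_unfold[of \<theta> "-1"] right_of_unfold[of \<theta> 0] \<theta> by simp_all
  have C: "cut \<theta> (1 ## left_of \<theta> (-2)) (2 ## right_of \<theta> 1)"
    unfolding cut_def by (rule exI[of _ 0]) (simp add: l r0)
  obtain x y where xy: "5773/10000 \<le> x" "x \<le> 7322/10000" "36/100 \<le> y" "y \<le> 7322/10000"
    and m: "3 + excess (2 * k) (ext_2211 (twos (2 * k) x)) (ext_2211 (twos (2 * k) y)) \<le> markov (periodic (omega k))"
    using markov_periodic_omega[OF k] by blast
  show ?thesis
  proof (rule classification[OF C _ _ refl xy])
    have "lambda_at 0 \<theta> = 2 + cfrac (1 ## left_of \<theta> (-2)) + cfrac (right_of \<theta> 1)"
      using l \<theta> by (simp add: lambda_at_eq[OF r])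
    then show "excess (2 * k) (ext_2211 (twos (2 * k) x)) (ext_2211 (twos (2 * k) y)) < cfrac (right_of \<theta> 1) + cfrac (1 ## left_of \<theta> (-2)) - 1"
      using big m by simp
    show "excess (2 * k) (4187/10000) (4187/10000) \<le> excess (2 * k) (ext_2211 (twos (2 * k) x)) (ext_2211 (twos (2 * k) y))"
      using xy by (intro excess_tail_ge N) auto
  qed
qed

lemma markov_periodic_omega_ge:
  assumes k: "1 \<le> k"
  shows "3 + excess (2 * k) (4187/10000) (4187/10000) \<le> markov (periodic (omega k))"
proof -
  have N: "even (2 * k)" "2 \<le> 2 * k" using k by auto
  obtain x y where xy: "5773/10000 \<le> x" "x \<le> 7322/10000" "36/100 \<le> y" "y \<le> 7322/10000"
    and m: "3 + excess (2 * k) (ext_2211 (twos (2 * k) x)) (ext_2211 (twos (2 * k) y)) \<le> markov (periodic (omega k))"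
    using markov_periodic_omega[OF k] by blast
  have "excess (2 * k) (4187/10000) (4187/10000) \<le> excess (2 * k) (ext_2211 (twos (2 * k) x)) (ext_2211 (twos (2 * k) y))"
    using xy by (intro excess_tail_ge N) auto
  then show ?thesis using m by simp
qed

text \<open>At a 1 the value is at most 1 + 2 * 0.7322, at a 2 between twos at most 2 + 2 * 0.4227;
  both are below 3.\<close>

lemma central_neighbours:
  assumes r: "range \<theta> \<subseteq> {1, 2}" and big: "3 < lambda_at 0 \<theta>"
  shows "\<theta> 0 = 2" "\<theta> (-1) = 1 \<or> \<theta> 1 = 1"
proof -
  have mem: "\<theta> i = 1 \<or> \<theta> i = 2" for i using r by blast
  show 0: "\<theta> 0 = 2"
    using big mem[of 0] cfrac_bounds(2)[OF words12_of(2)[OF r, of "-1"]] cfrac_bounds(2)[OF words12_of(1)[OF r, of 1]]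
    by (auto simp: lambda_at_eq[OF r])
  show "\<theta> (-1) = 1 \<or> \<theta> 1 = 1"
  proof (rule ccontr)
    assume "\<not> (\<theta> (-1) = 1 \<or> \<theta> 1 = 1)"
    then have *: "\<theta> (-1) = 2" "\<theta> 1 = 2" using mem by blast+
    have "left_of \<theta> (-1) = 2 ## left_of \<theta> (-2)" "right_of \<theta> 1 = 2 ## right_of \<theta> 2"
      using left_of_unfold[of \<theta> "-1"] right_of_unfold[of \<theta> 1] * by simp_all
    moreover have "cfrac (2 ## left_of \<theta> (-2)) \<le> 4227/10000" "cfrac (2 ## right_of \<theta> 2) \<le> 4227/10000"
      by (intro cfrac_2_bounds words12_of[OF r])+
    ultimately show False using big 0 by (simp add: lambda_at_eq[OF r])
  qed
qed

text \<open>Prefixing 1 1 is the map \<open>t -> 1 - 1/(2 + t)\<close>, whose derivative is at most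
  1/4 for t \<ge> 0.\<close>

lemma cfrac_ones_contract:
  assumes "s \<in> words12" "t \<in> words12"
  shows "\<bar>cfrac (replicate (2 * n) 1 @- s) - cfrac (replicate (2 * n) 1 @- t)\<bar> \<le> \<bar>cfrac s - cfrac t\<bar> / 4 ^ n"
proof (induction n)
  case (Suc n)
  define u v where "u = replicate (2 * n) 1 @- s" and "v = replicate (2 * n) 1 @- t"
  have w: "u \<in> words12" "v \<in> words12" using assms by (simp_all add: u_def v_def)
  have "\<bar>cfrac (1 ## 1 ## u) - cfrac (1 ## 1 ## v)\<bar> = \<bar>1 / (2 + cfrac u) - 1 / (2 + cfrac v)\<bar>"
    unfolding cfrac_11(2)[OF w(1)] cfrac_11(2)[OF w(2)] using w by (simp add: cfrac_Stream abs_minus_commute)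
  also have "\<dots> \<le> \<bar>cfrac u - cfrac v\<bar> / 2\<^sup>2"
    using cfrac_bounds1[OF w(1)] cfrac_bounds1[OF w(2)] by (intro inverse_diff_contract) auto
  also have "\<dots> \<le> \<bar>cfrac s - cfrac t\<bar> / 4 ^ n / 4"
    using Suc by (simp add: u_def v_def)
  finally show ?case by (simp add: u_def v_def mult.commute)
qed simp

text \<open>The leading 2 contributes one more factor 1/4, and two values differ by less than
  0.4.\<close>

lemma long_ones_gap:
  assumes "s \<in> words12" "t \<in> words12"
  shows "gap (replicate (2 * n) 1 @- s) (2 ## (replicate (2 * n) 1 @- t)) \<le> (1/10) / 4 ^ n"
proof -
  define u v where "u = replicate (2 * n) 1 @- s" and "v = replicate (2 * n) 1 @- t"
  have w: "u \<in> words12" "v \<in> words12" using assms by (simp_all add: u_def v_def)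
  have "gap u (2 ## v) = 1 / (2 + cfrac v) - 1 / (2 + cfrac u)"
    using w by (simp add: gap_def cfrac_Stream)
  also have "\<dots> \<le> \<bar>cfrac v - cfrac u\<bar> / 2\<^sup>2"
    using cfrac_bounds1[OF w(1)] cfrac_bounds1[OF w(2)] by (intro order_trans[OF abs_ge_self inverse_diff_contract]) auto
  also have "\<dots> \<le> \<bar>cfrac t - cfrac s\<bar> / 4 ^ n / 4"
    using cfrac_ones_contract[OF assms(2,1), of n] by (simp add: u_def v_def)
  also have "\<dots> \<le> (4/10) / 4 ^ n / 4"
  proof (intro divide_right_mono)
    show "\<bar>cfrac t - cfrac s\<bar> \<le> 4/10"
      using cfrac_bounds[OF assms(1)] cfrac_bounds[OF assms(2)] by (intro abs_leI) linarith+
  qed auto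
  finally show ?thesis by (simp add: u_def v_def)
qed

text \<open>Here n stands for j - 1. The hypothesis gives n \<ge> (2k-1) log 3 / log 2 + 2, that is
  \<open>2^n \<ge> 4 * 3^(2k-1)\<close>; squaring gives \<open>4^n \<ge> (16/9) * 9^(2k)\<close>,
  and 0.13 * 16/9 > 0.1.\<close>

lemma power_4_large:
  assumes k: "1 \<le> k" and n: "\<lfloor>(2 * real k - 1) * ln 3 / ln 2\<rfloor> + 3 < int (Suc n)"
  shows "(1/10) / 4 ^ n < (13/100) / (9::real) ^ (2 * k)"
proof -
  define x where "x = (2 * real k - 1) * ln 3 / ln 2"
  have "x + 2 \<le> real n" using n unfolding x_def[symmetric] by linarith
  then have "2 powr (x + 2) \<le> 2 powr real n" by (intro powr_mono) auto
  moreover have "2 powr x = 3 powr (2 * real k - 1)" by (simp add: x_def powr_def)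
  moreover have "3 powr (2 * real k - 1) = 3 ^ (2 * k) / 3"
    using powr_realpow[of 3 "2 * k"] by (simp add: powr_diff)
  ultimately have "4 * (3 ^ (2 * k) / 3) \<le> (2::real) ^ n"
    by (simp add: powr_add powr_realpow)
  then have "(4 * (3 ^ (2 * k) / 3))\<^sup>2 \<le> ((2::real) ^ n)\<^sup>2" by (intro power_mono) auto
  moreover have "((2::real) ^ n)\<^sup>2 = 4 ^ n" "((3::real) ^ (2 * k))\<^sup>2 = 9 ^ (2 * k)"
    by (simp_all add: power2_eq_square power_mult_distrib[symmetric])
  ultimately have *: "16 / 9 * 9 ^ (2 * k) \<le> (4::real) ^ n"
    by (simp add: power_mult_distrib power_divide)
  have "(1/10) * (9::real) ^ (2 * k) < (13/100) * (16 / 9 * 9 ^ (2 * k))" by simp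
  also have "\<dots> \<le> (13/100) * 4 ^ n" using * by (intro mult_left_mono) auto
  finally show ?thesis by (simp add: divide_simps mult.commute)
qed

theorem theorem9p22:
  fixes k :: nat
  assumes "k \<ge> 1"
  shows "\<exists>\<mu>::real. \<mu> > markov (gamma1 k) \<and>
    (\<forall>\<theta>. admissible k \<mu> \<theta> \<longrightarrow>
      (\<exists>\<eta> \<in> {\<theta>, transposition \<theta>}.
         has_form (replicate 4 1) ([2] @ [2] @ replicate 2 1) \<eta>
       \<or> has_form
           (replicate (2*k) 2 @ replicate 2 1 @ replicate (2*k+2) 2 @ replicate 2 1
              @ replicate (2*k) 2 @ replicate 2 1)
           ([2] @ replicate (2*k) 2 @ replicate 2 1 @ replicate (2*k+2) 2 @ replicate 2 1
              @ replicate (2*k) 2 @ [1]) \<eta>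
       \<or> (\<exists>m::nat. 1 \<le> m \<and> m < k \<and>
            has_form
              (replicate 2 1 @ replicate (2*m) 2 @ replicate 2 1)
              ([2] @ replicate (2*m+1) 2 @ replicate 2 1 @ replicate 2 2) \<eta>)
       \<or> (\<exists>m::nat. 1 < m \<and> m < k - 1 \<and>
            has_form
              (replicate 2 2 @ replicate 2 1 @ replicate (2*m-1) 2 @ replicate 2 1)
              ([2] @ replicate (2*m) 2 @ replicate 2 1 @ replicate 2 2) \<eta>))) \<and>
    (\<forall>\<theta>. admissible k \<mu> \<theta> \<and>
      has_form (replicate 4 1) ([2] @ [2] @ replicate 2 1) \<theta> \<longrightarrow>
      \<not> (\<exists>j m::nat. 0 < j \<and> 0 < m \<and>
           \<lfloor>(2 * real k - 1) * ln 3 / ln 2\<rfloor> + 3 < int j \<and> j \<le> m + 1 \<and>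
           has_form (replicate (2*j) 1) ([2] @ [2] @ replicate (2*m) 1) \<theta>))"
proof (intro exI[of _ "3 + excess (2 * k) (42/100) (42/100)"] conjI allI impI)
  let ?\<mu> = "3 + excess (2 * k) (42/100) (42/100)"
  have N: "even (2 * k)" "2 \<le> 2 * k" using assms by auto
  show "markov (gamma1 k) < ?\<mu>" by (rule markov_gamma1_less[OF assms])
  {
    fix \<theta> assume "admissible k ?\<mu> \<theta>"
    then have r: "range \<theta> \<subseteq> {1, 2}" and big: "markov (periodic (omega k)) < lambda_at 0 \<theta>"
      and small: "markov \<theta> < ?\<mu>" by (auto simp: admissible_def)
    have less: "lambda_at i \<theta> < ?\<mu>" for i using lambda_at_le_markov[OF r, of i] small by simp
    have big3: "3 < lambda_at 0 \<theta>"
      using big markov_periodic_omega_ge[OF assms] excess_pos[OF N] by linarith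
    note nb = central_neighbours[OF r big3]
    have forms: "has_form (replicate 4 1) ([2] @ [2] @ replicate 2 1) \<eta>
       \<or> has_form
           (replicate (2*k) 2 @ replicate 2 1 @ replicate (2*k+2) 2 @ replicate 2 1
              @ replicate (2*k) 2 @ replicate 2 1)
           ([2] @ replicate (2*k) 2 @ replicate 2 1 @ replicate (2*k+2) 2 @ replicate 2 1
              @ replicate (2*k) 2 @ [1]) \<eta>
       \<or> (\<exists>m::nat. 1 \<le> m \<and> m < k \<and>
            has_form
              (replicate 2 1 @ replicate (2*m) 2 @ replicate 2 1)
              ([2] @ replicate (2*m+1) 2 @ replicate 2 1 @ replicate 2 2) \<eta>)"
      if \<eta>: "range \<eta> \<subseteq> {1, 2}" "\<And>i. lambda_at i \<eta> < ?\<mu>" "markov (periodic (omega k)) < lambda_at 0 \<eta>"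
        "\<eta> 0 = 2" "\<eta> (-1) = 1" for \<eta>
    proof -
      have l: "left_of \<eta> (-1) = 1 ## left_of \<eta> (-2)" "right_of \<eta> 0 = 2 ## right_of \<eta> 1"
        using left_of_unfold[of \<eta> "-1"] right_of_unfold[of \<eta> 0] \<eta> by simp_all
      show ?thesis
        using forms_of_admissible[OF assms \<eta>] has_form_of_forms[OF l] by blast
    qed
    have forms: "\<exists>\<eta>\<in>{\<theta>, transposition \<theta>}.
        has_form (replicate 4 1) ([2] @ [2] @ replicate 2 1) \<eta>
       \<or> has_form
           (replicate (2*k) 2 @ replicate 2 1 @ replicate (2*k+2) 2 @ replicate 2 1
              @ replicate (2*k) 2 @ replicate 2 1)
           ([2] @ replicate (2*k) 2 @ replicate 2 1 @ replicate (2*k+2) 2 @ replicate 2 1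
              @ replicate (2*k) 2 @ [1]) \<eta>
       \<or> (\<exists>m::nat. 1 \<le> m \<and> m < k \<and>
            has_form
              (replicate 2 1 @ replicate (2*m) 2 @ replicate 2 1)
              ([2] @ replicate (2*m+1) 2 @ replicate 2 1 @ replicate 2 2) \<eta>)"
      using nb(2)
    proof
      assume "\<theta> (-1) = 1"
      then show ?thesis using forms[OF r less big nb(1)] by blast
    next
      assume "\<theta> 1 = 1"
      \<comment> \<open>If the neighbouring 1 is on the right, the transposition has it on the left,
        with the same \<lambda> at position 0 and the same bounds.\<close>
      have "range (transposition \<theta>) \<subseteq> {1, 2}" "transposition \<theta> 0 = 2" "transposition \<theta> (-1) = 1"
        using r nb(1) \<open>\<theta> 1 = 1\<close> by (auto simp: transposition_def)
      then show ?thesis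
        using forms[of "transposition \<theta>"] less big by (simp add: lambda_at_transposition[OF r])
    qed
    then show "\<exists>\<eta> \<in> {\<theta>, transposition \<theta>}.
         has_form (replicate 4 1) ([2] @ [2] @ replicate 2 1) \<eta>
       \<or> has_form
           (replicate (2*k) 2 @ replicate 2 1 @ replicate (2*k+2) 2 @ replicate 2 1
              @ replicate (2*k) 2 @ replicate 2 1)
           ([2] @ replicate (2*k) 2 @ replicate 2 1 @ replicate (2*k+2) 2 @ replicate 2 1
              @ replicate (2*k) 2 @ [1]) \<eta>
       \<or> (\<exists>m::nat. 1 \<le> m \<and> m < k \<and>
            has_form
              (replicate 2 1 @ replicate (2*m) 2 @ replicate 2 1)
              ([2] @ replicate (2*m+1) 2 @ replicate 2 1 @ replicate 2 2) \<eta>)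
       \<or> (\<exists>m::nat. 1 < m \<and> m < k - 1 \<and>
            has_form
              (replicate 2 2 @ replicate 2 1 @ replicate (2*m-1) 2 @ replicate 2 1)
              ([2] @ replicate (2*m) 2 @ replicate 2 1 @ replicate 2 2) \<eta>)"
      by blast
  }
  {
    fix \<theta> assume "admissible k ?\<mu> \<theta> \<and> has_form (replicate 4 1) ([2] @ [2] @ replicate 2 1) \<theta>"
    then have r: "range \<theta> \<subseteq> {1, 2}" and big: "markov (periodic (omega k)) < lambda_at 0 \<theta>"
      by (auto simp: admissible_def)
    show "\<not> (\<exists>j m::nat. 0 < j \<and> 0 < m \<and>
           \<lfloor>(2 * real k - 1) * ln 3 / ln 2\<rfloor> + 3 < int j \<and> j \<le> m + 1 \<and>
           has_form (replicate (2*j) 1) ([2] @ [2] @ replicate (2*m) 1) \<theta>)"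
    proof
      assume "\<exists>j m::nat. 0 < j \<and> 0 < m \<and>
           \<lfloor>(2 * real k - 1) * ln 3 / ln 2\<rfloor> + 3 < int j \<and> j \<le> m + 1 \<and>
           has_form (replicate (2*j) 1) ([2] @ [2] @ replicate (2*m) 1) \<theta>"
      then obtain j m :: nat where j: "0 < j" "\<lfloor>(2 * real k - 1) * ln 3 / ln 2\<rfloor> + 3 < int j" "j \<le> m + 1"
        and "has_form (replicate (2*j) 1) ([2] @ [2] @ replicate (2*m) 1) \<theta>" by blast
      then obtain l t where l: "left_of \<theta> (-1) = replicate (2 * j) 1 @- l"
        and t: "right_of \<theta> 0 = 2 ## 2 ## (replicate (2 * m) 1 @- t)"
        by (auto simp: has_form_iff)
      have w: "l \<in> words12" "t \<in> words12"
        using words12_of(2)[OF r, of "-1"] words12_of(1)[OF r, of 0] by (simp_all add: l t)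
      \<comment> \<open>The formula for \<lambda> - 3 consumes one pair of ones, so 2n = 2j - 2
        remain on the left; j \<le> m + 1 ensures that there are at least as many on the
        right.\<close>
      obtain n where n: "j = Suc n" using j(1) by (cases j) auto
      obtain d where "m = n + d" using j(3) n le_Suc_ex[of n m] by auto
      then have d: "replicate (2 * m) 1 @- t = replicate (2 * n) 1 @- (replicate (2 * d) 1 @- t)"
        by (simp add: replicate_shift_add[symmetric] algebra_simps)
      have l': "left_of \<theta> (-1) = 1 ## 1 ## (replicate (2 * n) 1 @- l)"
        using l by (simp add: n)
      have "\<theta> 0 = 2" "right_of \<theta> 1 = 2 ## (replicate (2 * m) 1 @- t)"
        using t right_of_unfold[of \<theta> 0] by simp_all
      then have "lambda_at 0 \<theta> = 3 + gap (replicate (2 * n) 1 @- l) (2 ## (replicate (2 * n) 1 @- (replicate (2 * d) 1 @- t)))"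
        using w by (simp add: lambda_at_eq[OF r] l' d cfrac_11(2) gap_def)
      also have "\<dots> \<le> 3 + (1/10) / 4 ^ n"
        using long_ones_gap[of l "replicate (2 * d) 1 @- t" n] w by simp
      also have "\<dots> < 3 + (13/100) / 9 ^ (2 * k)"
        using power_4_large[OF assms, of n] j(2) n by simp
      also have "\<dots> \<le> markov (periodic (omega k))"
        using excess_lower[OF N] markov_periodic_omega_ge[OF assms] by linarith
      finally show False using big by simp
    qed
  }
qed

end
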